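(* (i) For every real $q$ with $0<q<1$, $$\frac{(q^{1/2};q)_\infty\,(q^{3/2};q)_\infty^3}{(q;q)_\infty^2\,(q^2;q)_\infty^2} =\sum_{n=0}^{\infty}q^{3n^2}\frac{(q^{1/2};q)_n^6\,(q^{3/2};q)_{2n}^3\,(1-q^{n+\frac12})^2(1-q^{4n+\frac32})}{(q;q)_{2n}^3\,(q^2;q)_{3n}^2\,(1-q^{2n+1})(1-q^{2n+\frac12})}$$ $$\times\Bigg\{q^{2n}+\frac{(1+q^{n+\frac12})(1-q^{2n})(1-q^{3n+1})^2(1-q^{4n+\frac12})}{(1-q^{n+\frac12})(1-q^{2n+\frac12})^2(1-q^{4n+\frac32})}+\frac{q^{4n+1}(1-q^{2n+\frac12})(1-q^{2n+\frac32})(1-q^{4n+\frac52})}{(1+q^{n+\frac12})^2(1-q^{3n+2})^2(1-q^{4n+\frac32})}\Bigg\}.$$ (ii) The limiting case $q\to1$ gives $$\frac{32}{\pi^2}=\sum_{n=0}^{\infty}\frac{(\frac12)_n^6\,(\frac12)_{2n}^3}{((2n)!)^3\,((3n)!)^2}\cdot\frac{(1+2n)(1+4n)^2(3+8n)}{(1+3n)^2}$$ $$\times\Bigg\{1+\frac{32n(1+3n)^2(1+8n)}{(1+2n)(1+4n)^2(3+8n)}+\frac{(1+4n)(3+4n)(5+8n)}{16(2+3n)^2(3+8n)}\Bigg\}.$$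
   Context: $(x;q)_0=1$, $(x;q)_n=\prod_{j=0}^{n-1}(1-q^jx)$, $(x;q)_\infty=\prod_{j\ge0}(1-q^jx)$. Fractional powers of $q$ are the positive real ones. $(x)_0=1$ and $(x)_n=x(x+1)\cdots(x+n-1)$ is the ordinary shifted factorial. *)

theory Defs
  imports "HOL-Analysis.Analysis"
begin

definition qpoch :: "real \<Rightarrow> real \<Rightarrow> nat \<Rightarrow> real" where
  "qpoch x q n = (\<Prod>j<n. 1 - q ^ j * x)"

definition qpoch_inf :: "real \<Rightarrow> real \<Rightarrow> real" where
  "qpoch_inf x q = prodinf (\<lambda>j. 1 - q ^ j * x)"

text \<open>For \<open>\<bar>q\<bar> < 1\<close> the infinite product converges for every \<open>x\<close>, so \<^const>\<open>prodinf\<close> is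
  not used outside its domain of meaning.\<close>

lemma qpoch_inf_has_prod:
  assumes "\<bar>q\<bar> < 1"
  shows "(\<lambda>j. 1 - q ^ j * x) has_prod qpoch_inf x q"
proof -
  have "summable (\<lambda>j. \<bar>x\<bar> * \<bar>q\<bar> ^ j)"
    using assms by (intro summable_mult summable_geometric) auto
  hence "summable (\<lambda>j. norm ((1 - q ^ j * x) - 1))"
    by (simp add: abs_mult power_abs mult.commute)
  hence "abs_convergent_prod (\<lambda>j. 1 - q ^ j * x)"
    by (rule summable_imp_abs_convergent_prod)
  thus ?thesis
    unfolding qpoch_inf_def
    by (intro convergent_prod_has_prod abs_convergent_prod_imp_convergent_prod)
qed

end

(*
  Put br x = x in part (ii) and br x = q^(-x/2) - q^(x/2) in part (i).  Both functions satisfy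
  br x * br y = br z * br (x + y - z) + br (x - z) * br (y - z), and this identity alone implies
  a telescoping recurrence between two very-well-poised series (of 5F4 type, respectively
  6phi5 type)
    Omega (a; b, c, d, e) = sum_k br (a + 2 k) (b)_k (c)_k (d)_k (e)_k
                              / ((1+a-b)_k (1+a-c)_k (1+a-d)_k (1+a-e)_k),
  namely between Omega (a; b, c, d, e) and Omega (a+1; b, c, d, e+1).  Applying it with the roles
  of e, d, c in turn leads from (3n+1/2; 1/2, n+1/2, n+1/2, n+1/2) to the same point for n + 1, and
  the three boundary terms are the three terms in the braces of the theorem.  When e = a
  the boundary term vanishes, so the recurrence also evaluates the series
  at n = 0 as an infinite product (Wallis' product in the case br x = x).
*)
theory Submission
  imports Defs
begin

section \<open>Brackets and very-well-poised sums\<close>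

text \<open>Algebra alone does not give the theorem: each recurrence needs convergent series and a
  boundary term that vanishes at infinity, and a q-bracket grows exponentially while the identity
  grows linearly. The last two assumptions treat both at once. \<open>br_star\<close> says that
  \<open>br x / x\<close> is nondecreasing, so \<open>br x / br y <= x / y\<close> for
  \<open>0 < x <= y\<close>, and every ratio of shifted factorials is bounded by its classical
  counterpart. \<open>br_add_le\<close> splits a growing bracket into a product of brackets at the
  price of \<open>K\<close>, and these cancel against brackets gained in a denominator; the bound
  1/2 keeps the arguments away from the zero of \<open>br\<close>. The delicate point is n = 0,
  where the prefactor \<open>br (3*n)\<close> vanishes and the starting series diverges; the
  recursion therefore runs on a regularised quantity \<open>Y\<close>. The sum over n collapses to
  \<open>Y 0\<close> because the weights \<open>D n\<close> beat the growth of \<open>Y\<close>, and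
  \<open>Y 0\<close> is computed along a second chain of parameters whose series shrinks to its
  initial term.\<close>

locale bracket =
  fixes br :: "real \<Rightarrow> real" and K :: real
  assumes br_mult: "br x * br y = br z * br (x + y - z) + br (x - z) * br (y - z)"
    and br_pos: "0 < x \<Longrightarrow> 0 < br x"
    and br_star: "0 < x \<Longrightarrow> x \<le> y \<Longrightarrow> br x * y \<le> br y * x"
    and br_add_le: "1/2 \<le> x \<Longrightarrow> 1/2 \<le> y \<Longrightarrow> br (x + y) \<le> K * br x * br y"
begin

section \<open>Algebraic consequences of the addition identity\<close>

lemma br_0: "br 0 = 0"
  using br_mult[of 0 0 0] by simp

lemma br_minus_mult: "br (- x) * br (- y) = br x * br y"
  using br_mult[of x y "x + y"] by (simp add: br_0 mult.commute)

lemma br_mono: "0 < x \<Longrightarrow> x \<le> y \<Longrightarrow> br x \<le> br y"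
proof -
  assume a: "0 < x" "x \<le> y"
  have "br x * x \<le> br x * y" using a br_pos[of x] by simp
  also have "\<dots> \<le> br y * x" by (rule br_star) fact+
  finally show ?thesis using a by simp
qed

lemma br_ratio_le: "0 < x \<Longrightarrow> x \<le> y \<Longrightarrow> br x / br y \<le> x / y"
  using br_star[of x y] br_pos[of y] by (simp add: field_simps)

text \<open>Let X = \<open>br (a - b) * br (a - c)\<close>, Y =
  \<open>br (a - b - d) * br (a - c - d)\<close> and p = \<open>br b * br c\<close>. Three uses of
  \<open>br_mult\<close> express the other products as X - p, Y - p and X - Y, and the claim becomes
  (Y - p) X + p (X - Y) = (X - p) Y.\<close>

lemma br_mult4:
  "br (a - b - c - d) * br (a - b) * br (a - c) * br (a - d) + br b * br c * br d * br (2*a - b - c - d)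
   = br a * br (a - b - c) * br (a - b - d) * br (a - c - d)"
proof -
  have 1: "br (a - b) * br (a - c) = br a * br (a - b - c) + br b * br c"
    using br_mult[of "a - b" "a - c" a] br_minus_mult[of b c] by (simp add: algebra_simps)
  have 2: "br (a - b - d) * br (a - c - d) = br (a - d) * br (a - b - c - d) + br b * br c"
    using br_mult[of "a - b - d" "a - c - d" "a - d"] br_minus_mult[of b c]
    by (simp add: algebra_simps)
  have 3: "br (a - b) * br (a - c) = br d * br (2*a - b - c - d) + br (a - b - d) * br (a - c - d)"
    using br_mult[of "a - b" "a - c" d] by (simp add: algebra_simps)
  from 1 2 3 show ?thesis by algebra
qed

text \<open>This is the telescoping relation with all denominators cleared and \<open>k\<close>
  replaced by a real \<open>x\<close>. \<open>br_mult\<close> splits the two brackets on the left;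
  the remainder is \<open>br_mult4\<close> at \<open>1 + a + 2*x\<close>, \<open>b + x\<close>,
  \<open>c + x\<close>, \<open>d + x\<close>, where the differences are exactly the factors of
  \<open>P\<close>.\<close>

lemma br_very_well_poised:
  fixes a b c d e x :: real
  defines "P \<equiv> br (1 + a - b + x) * br (1 + a - c + x) * br (1 + a - d + x)"
  shows "br (1 + 2*a - b - c - d - e) * br (a + 2*x) * P =
     br (a - e + x) * br (1 + 2*a - b - c - d + x) * P
     - br (b + x) * br (c + x) * br (d + x) * br (e + x) * br (2 + 2*a - b - c - d + x)
     + br (e + x) * br (1 + a + 2*x) * br (1 + a - b - c) * br (1 + a - b - d) * br (1 + a - c - d)"
proof -
  have 1: "br (1 + 2*a - b - c - d - e) * br (a + 2*x) =
     br (a - e + x) * br (1 + 2*a - b - c - d + x) + br (1 + a - b - c - d - x) * br (e + x)"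
    using br_mult[of "1 + 2*a - b - c - d - e" "a + 2*x" "a - e + x"] by (simp add: algebra_simps)
  have 2: "br (1 + a - b - c - d - x) * P
      + br (b + x) * br (c + x) * br (d + x) * br (2 + 2*a - b - c - d + x)
      = br (1 + a + 2*x) * br (1 + a - b - c) * br (1 + a - b - d) * br (1 + a - c - d)"
    using br_mult4[of "1 + a + 2*x" "b + x" "c + x" "d + x"]
    by (simp add: P_def algebra_simps)
  from 1 2 show ?thesis by algebra
qed

section \<open>Shifted factorials and the telescoping recurrence\<close>

definition rp :: "real \<Rightarrow> nat \<Rightarrow> real" where
  "rp x n = (\<Prod>j<n. br (x + real j))"

lemma rp_0 [simp]: "rp x 0 = 1"
  by (simp add: rp_def)

lemma rp_Suc: "rp x (Suc n) = rp x n * br (x + real n)"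
  by (simp add: rp_def)

lemma rp_Suc': "rp x (Suc n) = br x * rp (x + 1) n"
  unfolding rp_def prod.lessThan_Suc_shift by (simp add: algebra_simps)

lemma rp_pos: "0 < x \<Longrightarrow> 0 < rp x n"
  unfolding rp_def by (intro prod_pos) (auto intro!: br_pos)

lemma rp_add: "rp x (m + n) = rp x m * rp (x + real m) n"
  by (induction n) (simp_all add: rp_Suc algebra_simps)

definition R :: "real \<Rightarrow> real \<Rightarrow> real \<Rightarrow> real \<Rightarrow> real \<Rightarrow> nat \<Rightarrow> real" where
  "R a b c d e k = rp b k * rp c k * rp d k * rp e k /
     (rp (1 + a - b) k * rp (1 + a - c) k * rp (1 + a - d) k * rp (1 + a - e) k)"

definition T :: "real \<Rightarrow> real \<Rightarrow> real \<Rightarrow> real \<Rightarrow> real \<Rightarrow> nat \<Rightarrow> real" where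
  "T a b c d e k = br (a + 2 * real k) * R a b c d e k"

text \<open>The telescoping certificate. At \<open>Suc k\<close> its factor
  \<open>br (a - e + real k)\<close> cancels the factor \<open>br (1 + a - e + real k)\<close> that
  the denominator of \<open>R\<close> has just gained.\<close>

definition H :: "real \<Rightarrow> real \<Rightarrow> real \<Rightarrow> real \<Rightarrow> real \<Rightarrow> nat \<Rightarrow> real" where
  "H a b c d e k = br (a - e + real k) * br (1 + 2*a - b - c - d + real k) * R a b c d e k"

definition M :: "real \<Rightarrow> real \<Rightarrow> real \<Rightarrow> real \<Rightarrow> real \<Rightarrow> real" where
  "M a b c d e = br e * br (1 + a - b - c) * br (1 + a - b - d) * br (1 + a - c - d) /
     (br (1 + a - b) * br (1 + a - c) * br (1 + a - d))"

lemma R_Suc: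
  "R a b c d e (Suc k) = R a b c d e k * (br (b + real k) * br (c + real k) * br (d + real k) * br (e + real k)) /
     (br (1 + a - b + real k) * br (1 + a - c + real k) * br (1 + a - d + real k) * br (1 + a - e + real k))"
  by (simp add: R_def rp_Suc ac_simps)

text \<open>Raising \<open>a\<close> and \<open>e\<close> together fixes \<open>1 + a - e\<close>
  and shifts four other arguments by one; each shift multiplies \<open>rp y k\<close> by
  \<open>br (y + real k) / br y\<close>. The cross-multiplied form matches the cleared identity
  \<open>br_very_well_poised\<close>.\<close>

lemma R_shift:
  assumes "b < 1 + a" "c < 1 + a" "d < 1 + a" "e < 1 + a"  "0 < e"
  shows "R (a + 1) b c d (e + 1) k * br e * br (1 + a - b + real k) * br (1 + a - c + real k) * br (1 + a - d + real k)
    = R a b c d e k * br (e + real k) * br (1 + a - b) * br (1 + a - c) * br (1 + a - d)"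
proof -
  have s: "rp (y + 1) k = rp y k * br (y + real k) / br y" if "0 < y" for y
    using rp_Suc[of y k] rp_Suc'[of y k] br_pos[OF that] by (simp add: field_simps)
  have eq: "1 + (a + 1) - b = (1 + a - b) + 1" "1 + (a + 1) - c = (1 + a - c) + 1"
    "1 + (a + 1) - d = (1 + a - d) + 1" "1 + (a + 1) - (e + 1) = 1 + a - e"  by auto
  have nz: "br e \<noteq> 0" "br (1 + a - b) \<noteq> 0" "br (1 + a - c) \<noteq> 0" "br (1 + a - d) \<noteq> 0"
     "br (1 + a - b + real k) \<noteq> 0" "br (1 + a - c + real k) \<noteq> 0" "br (1 + a - d + real k) \<noteq> 0"
    using assms by (auto intro!: br_pos less_imp_neq[symmetric])
  have nz': "rp (1 + a - b) k \<noteq> 0" "rp (1 + a - c) k \<noteq> 0" "rp (1 + a - d) k \<noteq> 0" "rp (1 + a - e) k \<noteq> 0"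
    using assms by (auto intro!: rp_pos less_imp_neq[symmetric])
  have p: "0 < 1 + a - b" "0 < 1 + a - c" "0 < 1 + a - d" using assms by auto
  show ?thesis unfolding R_def eq s[OF assms(5)] s[OF p(1)] s[OF p(2)] s[OF p(3)]
    using nz nz' by (simp add: divide_simps) 
qed

text \<open>\<open>br_very_well_poised\<close> at \<open>x = real k\<close>, multiplied by
  \<open>R a b c d e k\<close> and divided by \<open>P\<close>, the product of the three new
  denominator factors that \<open>H\<close> at \<open>Suc k\<close> does not cancel.\<close>

lemma T_telescope:
  assumes "b < 1 + a" "c < 1 + a" "d < 1 + a" "e < 1 + a"  "0 < e"
  shows "br (1 + 2*a - b - c - d - e) * T a b c d e k =
    H a b c d e k - H a b c d e (Suc k) + M a b c d e * T (a + 1) b c d (e + 1) k"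
proof -
  define x where "x = real k"
  define P where "P = br (1 + a - b + x) * br (1 + a - c + x) * br (1 + a - d + x)"
  have nz: "br e \<noteq> 0" "br (1 + a - b) \<noteq> 0" "br (1 + a - c) \<noteq> 0" "br (1 + a - d) \<noteq> 0"
     "br (1 + a - b + x) \<noteq> 0" "br (1 + a - c + x) \<noteq> 0" "br (1 + a - d + x) \<noteq> 0" "br (1 + a - e + x) \<noteq> 0"
    using assms by (auto intro!: br_pos less_imp_neq[symmetric] simp: x_def)
  have P: "P \<noteq> 0" using nz by (simp add: P_def)
  note id = br_very_well_poised[of a b c d e x, folded P_def]
  define r where "r = R a b c d e k"
  have H1: "H a b c d e (Suc k) * P =
     br (b + x) * br (c + x) * br (d + x) * br (e + x) * br (2 + 2*a - b - c - d + x) * r"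
    unfolding H_def R_Suc using nz by (simp add: P_def x_def r_def field_simps)
  have T1: "M a b c d e * T (a + 1) b c d (e + 1) k * P =
     br (e + x) * br (1 + a + 2*x) * br (1 + a - b - c) * br (1 + a - b - d) * br (1 + a - c - d) * r"
  proof -
    have "M a b c d e * T (a + 1) b c d (e + 1) k * P = 
      br (1 + a - b - c) * br (1 + a - b - d) * br (1 + a - c - d) * br (1 + a + 2*x) / 
     (br (1 + a - b) * br (1 + a - c) * br (1 + a - d)) * 
      (R (a + 1) b c d (e + 1) k * br e * br (1 + a - b + real k) * br (1 + a - c + real k) * br (1 + a - d + real k))"
      by (simp add: M_def T_def P_def x_def algebra_simps)
    also have "\<dots> = br (1 + a - b - c) * br (1 + a - b - d) * br (1 + a - c - d) * br (1 + a + 2*x) / 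
     (br (1 + a - b) * br (1 + a - c) * br (1 + a - d)) * 
      (r * br (e + real k) * br (1 + a - b) * br (1 + a - c) * br (1 + a - d))"
      unfolding R_shift[OF assms] r_def ..
    finally show ?thesis using nz by (simp add: x_def field_simps)
  qed
  have "br (1 + 2*a - b - c - d - e) * T a b c d e k * P =
    (H a b c d e k - H a b c d e (Suc k) + M a b c d e * T (a + 1) b c d (e + 1) k) * P"
    unfolding distrib_right left_diff_distrib H1 T1
    unfolding T_def H_def r_def[symmetric] x_def[symmetric]
    using id by algebra
  then show ?thesis using P by simp
qed

lemma H_0: "H a b c d e 0 = br (a - e) * br (1 + 2*a - b - c - d)"
  by (simp add: H_def R_def)

lemma suminf_T_shift:
  assumes "b < 1 + a" "c < 1 + a" "d < 1 + a" "e < 1 + a"  "0 < e"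
    and T: "summable (T a b c d e)" and T': "summable (T (a + 1) b c d (e + 1))"
    and H: "H a b c d e \<longlonglongrightarrow> 0"
  shows "br (1 + 2*a - b - c - d - e) * suminf (T a b c d e) =
    br (a - e) * br (1 + 2*a - b - c - d) + M a b c d e * suminf (T (a + 1) b c d (e + 1))"
proof -
  have "(\<lambda>k. H a b c d e k - H a b c d e (Suc k)) sums (H a b c d e 0 - 0)"
    by (rule telescope_sums') fact
  from sums_add[OF this sums_mult[OF summable_sums[OF T'], of "M a b c d e"]]
  have "(\<lambda>k. br (1 + 2*a - b - c - d - e) * T a b c d e k) sums
      (H a b c d e 0 + M a b c d e * suminf (T (a + 1) b c d (e + 1)))"
    using T_telescope[OF assms(1-5)] by simp
  moreover have "(\<lambda>k. br (1 + 2*a - b - c - d - e) * T a b c d e k) sums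
     (br (1 + 2*a - b - c - d - e) * suminf (T a b c d e))"
    by (intro sums_mult summable_sums T)
  ultimately show ?thesis by (simp add: sums_unique2 H_0)
qed

section \<open>Bounds on brackets and on ratios of shifted factorials\<close>

lemma K_pos: "0 < K"
proof -
  have "0 < br 1" by (simp add: br_pos)
  also have "br 1 \<le> K * br (1/2) * br (1/2)" using br_add_le[of "1/2" "1/2"] by simp
  finally show ?thesis
    using br_pos[of "1/2"] by (simp add: zero_less_mult_iff)
qed

lemma br_nonneg: "0 \<le> x \<Longrightarrow> 0 \<le> br x"
  using br_pos[of x] by (cases "x = 0") (auto simp: br_0)

lemma br_mono0: "0 \<le> x \<Longrightarrow> x \<le> y \<Longrightarrow> br x \<le> br y"
  using br_mono[of x y] br_nonneg[of y] by (cases "x = 0") (auto simp: br_0)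

lemma br_add_le3:
  assumes "1/2 \<le> x" "1/2 \<le> y" "1/2 \<le> z"
  shows "br (x + y + z) \<le> K^2 * br x * br y * br z"
proof -
  have "br (x + y + z) \<le> K * br (x + y) * br z" using assms by (intro br_add_le) auto
  also have "\<dots> \<le> K * (K * br x * br y) * br z"
    using assms K_pos by (intro mult_right_mono mult_left_mono br_add_le br_nonneg) auto
  finally show ?thesis by (simp add: power2_eq_square mult_ac)
qed

lemma rp_ratio: "rp x k / rp y k = (\<Prod>j<k. br (x + real j) / br (y + real j))"
  by (simp add: rp_def prod_dividef)

lemma rp_ratio_nonneg: "0 < x \<Longrightarrow> 0 < y \<Longrightarrow> 0 \<le> rp x k / rp y k"
  using rp_pos[of x k] rp_pos[of y k] by simp

lemma rp_ratio_le:
  assumes "0 < x" "x \<le> y" and "\<And>j. (x + real j) / (y + real j) \<le> f j"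
  shows "rp x k / rp y k \<le> (\<Prod>j<k. f j)"
  unfolding rp_ratio
proof (intro prod_mono conjI)
  fix j assume "j \<in> {..<k}"
  show "0 \<le> br (x + real j) / br (y + real j)"
    using assms by (intro divide_nonneg_nonneg br_nonneg) auto
  have "br (x + real j) / br (y + real j) \<le> (x + real j) / (y + real j)"
    using assms by (intro br_ratio_le) auto
  then show "br (x + real j) / br (y + real j) \<le> f j" using assms(3)[of j] by linarith
qed

lemma rp_ratio_le_1: "0 < x \<Longrightarrow> x \<le> y \<Longrightarrow> rp x k / rp y k \<le> 1"
  using rp_ratio_le[of x y "\<lambda>_. 1" k] by simp

text \<open>Gives up a unit of the gap between numerator and denominator in exchange for an explicit
  \<open>br (c + real k)\<close> below, which can absorb a growing bracket.\<close>

lemma rp_ratio_split: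
  assumes "0 < c" shows "rp c k / rp C k = br c / br (c + real k) * (rp (c + 1) k / rp C k)"
  using rp_Suc[of c k] rp_Suc'[of c k] br_pos[of "c + real k"] assms by (simp add: field_simps)

end

section \<open>Majorants of order k^(-1/2)\<close>

definition hrp :: "real \<Rightarrow> nat \<Rightarrow> real" where
  "hrp s k = (\<Prod>j<k. (s + real j) / (s + 1/2 + real j))"

lemma hrp_nonneg: "0 \<le> s \<Longrightarrow> 0 \<le> hrp s k"
  unfolding hrp_def by (intro prod_nonneg) auto

text \<open>By induction: with x = s + k the step is \<open>x * (x + 1) <= (x + 1/2)^2\<close>. A
  gap of 1/2 thus gives decay of order k^(-1/2), so the fourth power is summable.\<close>

lemma hrp_square_le: "0 < s \<Longrightarrow> (hrp s k)^2 \<le> s / (s + real k)"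
proof (induction k)
  case (Suc k)
  define x where "x = s + real k"
  have x: "0 < x" using Suc by (simp add: x_def)
  have "(hrp s (Suc k))^2 = (hrp s k)^2 * (x / (x + 1/2))^2"
    by (simp add: hrp_def x_def power_mult_distrib power_divide add_ac)
  also have "\<dots> \<le> s / x * (x / (x + 1/2))^2"
    using Suc by (intro mult_right_mono) (auto simp: x_def)
  also have "\<dots> = s * x / (x + 1/2)^2"
    using x by (simp add: power_divide) (simp add: power2_eq_square)
  also have "\<dots> \<le> s * x / (x * (x + 1))"
  proof (rule divide_left_mono)
    show "x * (x + 1) \<le> (x + 1/2)^2" by (simp add: power2_eq_square algebra_simps)
    show "0 \<le> s * x" using x Suc.prems by simp
    show "0 < (x + 1/2)^2 * (x * (x + 1))"
      using x by (intro mult_pos_pos zero_less_power) auto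
  qed
  also have "\<dots> = s / (x + 1)" using x by simp
  finally show ?case by (simp add: x_def algebra_simps)
qed (simp add: hrp_def)

lemma hrp_power4_le: "0 < s \<Longrightarrow> (hrp s k)^4 \<le> (s / (s + real k))^2"
  using power_mono[OF hrp_square_le[of s k], of 2] by (simp add: power_mult[symmetric])

lemma summable_shifted_inverse_squares:
  assumes "0 < s" shows "summable (\<lambda>k. (s / (s + real k))^2)"
proof (rule summable_comparison_test')
  show "summable (\<lambda>k. s^2 * inverse (real k ^ 2))"
    by (intro summable_mult inverse_power_summable) simp
  show "norm ((s / (s + real k))^2) \<le> s^2 * inverse (real k ^ 2)" if "1 \<le> k" for k
  proof -
    have "(s / (s + real k))^2 \<le> (s / real k)^2"
      using assms that by (intro power_mono divide_left_mono) auto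
    then show ?thesis by (simp add: field_simps)
  qed
qed

lemma summable_hrp_power4: "0 < s \<Longrightarrow> summable (\<lambda>k. (hrp s k)^4)"
  by (rule summable_comparison_test'[OF summable_shifted_inverse_squares[of s], of 0])
     (auto simp: hrp_power4_le)

lemma hrp_power4_tendsto_0: "0 < s \<Longrightarrow> (\<lambda>k. (hrp s k)^4) \<longlonglongrightarrow> 0"
  by (rule summable_LIMSEQ_zero[OF summable_hrp_power4])

section \<open>Convergence of the very-well-poised series\<close>

context bracket
begin

text \<open>The condition \<open>x * (s + 1/2) <= s * y\<close> is the comparison of the factors at
  \<open>j = 0\<close>; \<open>x + 1/2 <= y\<close> compares the coefficients of \<open>j\<close>
  after cross-multiplication.\<close>

lemma rp_ratio_le_hrp:
  assumes "0 < x" "x + 1/2 \<le> y" "x * (s + 1/2) \<le> s * y" "0 < s"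
  shows "rp x k / rp y k \<le> hrp s k"
  unfolding hrp_def
proof (rule rp_ratio_le)
  fix j
  have "real j * (x + 1/2) \<le> real j * y" using assms by (intro mult_left_mono) auto
  then have "(x + real j) * (s + 1/2 + real j) \<le> (s + real j) * (y + real j)"
    using assms by (simp add: algebra_simps add_divide_distrib)
  then show "(x + real j) / (y + real j) \<le> (s + real j) / (s + 1/2 + real j)"
    using assms by (simp add: pos_divide_le_eq pos_le_divide_eq)
qed (use assms in auto)

text \<open>The last condition, together with the middle one, gives
  \<open>(x + j) / (y + j) \<le> (5/2 + j) / (3 + j)\<close> for all \<open>j \<ge> 0\<close>; \<open>5/2\<close> is the least
  value that serves all the states of the recursion, also at \<open>m = 0\<close>.\<close>

definition half_gap :: "real \<Rightarrow> real \<Rightarrow> bool" where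
  "half_gap x y \<longleftrightarrow> 0 < x \<and> x + 1/2 \<le> y \<and> 6 * x \<le> 5 * y"

lemma rp_ratio_half_gap: "half_gap x y \<Longrightarrow> rp x k / rp y k \<le> hrp (5/2) k"
  by (rule rp_ratio_le_hrp) (auto simp: half_gap_def)

text \<open>Two of the four ratios each surrender a bracket by \<open>rp_ratio_split\<close>, enough
  to absorb the growth of \<open>T\<close> and of \<open>H\<close>. A gap of 1/2 is still left in
  all four, whence the fourth power of \<open>hrp\<close>.\<close>

lemma rp_quotient_le:
  assumes "0 < b" "half_gap (b + 1) B" "0 < c" "half_gap (c + 1) C" "half_gap d D" "half_gap e E"
  shows "rp b k * rp c k * rp d k * rp e k / (rp B k * rp C k * rp D k * rp E k)
    \<le> br b * br c / (br (b + real k) * br (c + real k)) * (hrp (5/2) k)^4"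
proof -
  have p: "0 < B" "0 < C" "0 < D" "0 < E" "0 < d" "0 < e"
    using assms by (auto simp: half_gap_def)
  have "rp b k * rp c k * rp d k * rp e k / (rp B k * rp C k * rp D k * rp E k)
    = (rp b k / rp B k) * (rp c k / rp C k) * (rp d k / rp D k) * (rp e k / rp E k)"
    by (simp add: field_simps)
  also have "\<dots> = br b * br c / (br (b + real k) * br (c + real k)) *
     ((rp (b + 1) k / rp B k) * (rp (c + 1) k / rp C k) * (rp d k / rp D k) * (rp e k / rp E k))"
    unfolding rp_ratio_split[OF assms(1)] rp_ratio_split[OF assms(3)] by (simp add: field_simps)
  also have "\<dots> \<le> br b * br c / (br (b + real k) * br (c + real k)) *
      (hrp (5/2) k * hrp (5/2) k * hrp (5/2) k * hrp (5/2) k)"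
    using assms p by (intro mult_left_mono mult_mono rp_ratio_half_gap assms rp_ratio_nonneg
      mult_nonneg_nonneg divide_nonneg_nonneg br_nonneg hrp_nonneg) auto
  finally show ?thesis by (simp add: power4_eq_xxxx mult_ac)
qed

lemma R_nonneg:
  assumes "0 < b" "0 < c" "0 < d" "0 < e" "b < 1 + a" "c < 1 + a" "d < 1 + a" "e < 1 + a"
  shows "0 \<le> R a b c d e k"
  unfolding R_def using assms
  by (intro divide_nonneg_nonneg mult_nonneg_nonneg less_imp_le[OF rp_pos]) auto

text \<open>Write \<open>a + 2*k\<close> as \<open>(1/2 + k) + (g + k) + (a - g - 1/2)\<close>. All
  three summands are at least 1/2, so \<open>br_add_le3\<close> applies and the two brackets
  depending on \<open>k\<close> cancel against the bound for \<open>R\<close>. The explicit bound on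
  the sum is kept because the growth in \<open>m\<close> matters later.\<close>

lemma summable_T:
  assumes pos: "0 < a" "\<And>k. 0 \<le> R a b c d e k"
    and R: "\<And>k. R a b c d e k \<le> A / (br (1/2 + real k) * br (g + real k)) * (hrp (5/2) k)^4"
    and g: "1/2 \<le> g" "g + 1 \<le> a"
  shows "summable (T a b c d e)"
    and "suminf (T a b c d e) \<le> K^2 * br (a - g - 1/2) * A * (\<Sum>k. (hrp (5/2) k)^4)"
    and "0 \<le> suminf (T a b c d e)"
proof -
  have T0: "0 \<le> T a b c d e k" for k
    unfolding T_def using pos by (intro mult_nonneg_nonneg br_nonneg) auto
  have T: "T a b c d e k \<le> K^2 * br (a - g - 1/2) * A * (hrp (5/2) k)^4" for k
  proof -
    have nz: "0 < br (1/2 + real k)" "0 < br (g + real k)" using g by (auto intro!: br_pos)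
    have "br (a + 2 * real k) \<le> K^2 * br (1/2 + real k) * br (g + real k) * br (a - g - 1/2)"
      using br_add_le3[of "1/2 + real k" "g + real k" "a - g - 1/2"] g by (simp add: algebra_simps)
    then have "T a b c d e k \<le> (K^2 * br (1/2 + real k) * br (g + real k) * br (a - g - 1/2)) *
       (A / (br (1/2 + real k) * br (g + real k)) * (hrp (5/2) k)^4)"
      unfolding T_def using pos g K_pos
      by (intro mult_mono R mult_nonneg_nonneg br_nonneg) auto
    then show ?thesis using nz by (simp add: field_simps)
  qed
  have S: "summable (\<lambda>k. K^2 * br (a - g - 1/2) * A * (hrp (5/2) k)^4)"
    by (intro summable_mult summable_hrp_power4) simp
  show 1: "summable (T a b c d e)"
    by (rule summable_comparison_test'[OF S, of 0]) (use T T0 in auto)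
  show "0 \<le> suminf (T a b c d e)" by (intro suminf_nonneg 1 T0)
  have "suminf (T a b c d e) \<le> (\<Sum>k. K^2 * br (a - g - 1/2) * A * (hrp (5/2) k)^4)"
    by (intro suminf_le T 1 S)
  also have "\<dots> = K^2 * br (a - g - 1/2) * A * (\<Sum>k. (hrp (5/2) k)^4)"
    by (intro suminf_mult summable_hrp_power4) simp
  finally show "suminf (T a b c d e) \<le> K^2 * br (a - g - 1/2) * A * (\<Sum>k. (hrp (5/2) k)^4)" .
qed

text \<open>The same cancellation as for \<open>T\<close>: the two brackets of \<open>H\<close> are
  split off along \<open>1/2 + k\<close> and \<open>g + k\<close>, leaving a multiple of the null
  sequence \<open>hrp (5/2) k ^ 4\<close>.\<close>

lemma H_tendsto_0:
  assumes R0: "\<And>k. 0 \<le> R a b c d e k"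
    and R: "\<And>k. R a b c d e k \<le> A / (br (1/2 + real k) * br (g + real k)) * (hrp (5/2) k)^4"
    and g: "1/2 \<le> g" "e + 1 \<le> a" "g + 1/2 \<le> 1 + 2*a - b - c - d"
  shows "H a b c d e \<longlonglongrightarrow> 0"
proof (rule tendsto_sandwich)
  let ?C = "K * br (a - e - 1/2) * (K * br (1 + 2*a - b - c - d - g)) * A"
  show "\<forall>\<^sub>F k in sequentially. 0 \<le> H a b c d e k"
    unfolding H_def using g by (intro always_eventually allI mult_nonneg_nonneg br_nonneg R0) auto
  have "H a b c d e k \<le> ?C * (hrp (5/2) k)^4" for k
  proof -
    have nz: "0 < br (1/2 + real k)" "0 < br (g + real k)" using g by (auto intro!: br_pos)
    have 1: "br (a - e + real k) \<le> K * br (1/2 + real k) * br (a - e - 1/2)"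
      using br_add_le[of "1/2 + real k" "a - e - 1/2"] g by (simp add: algebra_simps)
    have 2: "br (1 + 2*a - b - c - d + real k) \<le> K * br (g + real k) * br (1 + 2*a - b - c - d - g)"
      using br_add_le[of "g + real k" "1 + 2*a - b - c - d - g"] g by (simp add: algebra_simps)
    have "H a b c d e k \<le> (K * br (1/2 + real k) * br (a - e - 1/2)) *
       (K * br (g + real k) * br (1 + 2*a - b - c - d - g)) *
       (A / (br (1/2 + real k) * br (g + real k)) * (hrp (5/2) k)^4)"
      unfolding H_def using g K_pos
      by (intro mult_mono R0 1 2 R mult_nonneg_nonneg br_nonneg) auto
    then show ?thesis using nz by (simp add: field_simps)
  qed
  then show "\<forall>\<^sub>F k in sequentially. H a b c d e k \<le> ?C * (hrp (5/2) k)^4" by simp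
  show "(\<lambda>k. ?C * (hrp (5/2) k)^4) \<longlonglongrightarrow> 0"
    by (intro tendsto_mult_right_zero hrp_power4_tendsto_0) simp
qed auto

lemma R_states:
  fixes m :: real
  assumes m: "0 \<le> m"
  shows R_state1_le: "R (3*m + 3/2) (1/2) (m + 1/2) (m + 3/2) (m + 1/2) k \<le>
      br (1/2) * br (m + 1/2) / (br (1/2 + real k) * br (m + 1/2 + real k)) * (hrp (5/2) k)^4"
    and R_state2_le: "R (3*m + 5/2) (1/2) (m + 3/2) (m + 3/2) (m + 1/2) k \<le>
      br (1/2) * br (m + 1/2) / (br (1/2 + real k) * br (m + 1/2 + real k)) * (hrp (5/2) k)^4"
    and R_state3_le: "R (3*m + 7/2) (1/2) (m + 3/2) (m + 3/2) (m + 3/2) k \<le>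
      br (1/2) * br (m + 3/2) / (br (1/2 + real k) * br (m + 3/2 + real k)) * (hrp (5/2) k)^4"
proof -
  have "R (3*m + 3/2) (1/2) (m + 1/2) (m + 3/2) (m + 1/2) k =
     rp (1/2) k * rp (m + 1/2) k * rp (m + 3/2) k * rp (m + 1/2) k /
     (rp (3*m + 2) k * rp (2*m + 2) k * rp (2*m + 2) k * rp (2*m + 1) k)"
    unfolding R_def by (simp add: algebra_simps)
  also have "\<dots> \<le> br (1/2) * br (m + 1/2) / (br (1/2 + real k) * br (m + 1/2 + real k)) * (hrp (5/2) k)^4"
    by (intro rp_quotient_le) (use m in \<open>auto simp: half_gap_def\<close>)
  finally show "R (3*m + 3/2) (1/2) (m + 1/2) (m + 3/2) (m + 1/2) k \<le>
      br (1/2) * br (m + 1/2) / (br (1/2 + real k) * br (m + 1/2 + real k)) * (hrp (5/2) k)^4" .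
  \<comment> \<open>The entry \<open>m + 1/2\<close> is moved to second place, so that it, and not
    an entry \<open>m + 3/2\<close>, is the one that gives up a bracket; its partner is
    \<open>2*m + 3\<close>.\<close>
  have "R (3*m + 5/2) (1/2) (m + 3/2) (m + 3/2) (m + 1/2) k =
     rp (1/2) k * rp (m + 1/2) k * rp (m + 3/2) k * rp (m + 3/2) k /
     (rp (3*m + 3) k * rp (2*m + 3) k * rp (2*m + 2) k * rp (2*m + 2) k)"
    unfolding R_def by (simp add: algebra_simps)
  also have "\<dots> \<le> br (1/2) * br (m + 1/2) / (br (1/2 + real k) * br (m + 1/2 + real k)) * (hrp (5/2) k)^4"
    by (intro rp_quotient_le) (use m in \<open>auto simp: half_gap_def\<close>)
  finally show "R (3*m + 5/2) (1/2) (m + 3/2) (m + 3/2) (m + 1/2) k \<le>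
      br (1/2) * br (m + 1/2) / (br (1/2 + real k) * br (m + 1/2 + real k)) * (hrp (5/2) k)^4" .
  have "R (3*m + 7/2) (1/2) (m + 3/2) (m + 3/2) (m + 3/2) k =
     rp (1/2) k * rp (m + 3/2) k * rp (m + 3/2) k * rp (m + 3/2) k /
     (rp (3*m + 4) k * rp (2*m + 3) k * rp (2*m + 3) k * rp (2*m + 3) k)"
    unfolding R_def by (simp add: algebra_simps)
  also have "\<dots> \<le> br (1/2) * br (m + 3/2) / (br (1/2 + real k) * br (m + 3/2 + real k)) * (hrp (5/2) k)^4"
    \<comment> \<open>For the pair \<open>m + 5/2\<close>, \<open>2*m + 3\<close>, both upper bounds
      on \<open>x\<close> in \<open>half_gap\<close> are equalities at \<open>m = 0\<close>.\<close>
    by (intro rp_quotient_le) (use m in \<open>auto simp: half_gap_def\<close>)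
  finally show "R (3*m + 7/2) (1/2) (m + 3/2) (m + 3/2) (m + 3/2) k \<le>
      br (1/2) * br (m + 3/2) / (br (1/2 + real k) * br (m + 3/2 + real k)) * (hrp (5/2) k)^4" .
qed

section \<open>The recursion from n to n + 1\<close>

lemma T_commute: "T a b c d e = T a b c e d" "T a b c d e = T a b d c e"
  by (auto simp: T_def R_def fun_eq_iff mult_ac)

definition Omega :: "real \<Rightarrow> real" where
  "Omega m = suminf (T (3*m + 3/2) (1/2) (m + 1/2) (m + 3/2) (m + 1/2))"

definition V :: real where "V = (\<Sum>k. (hrp (5/2) k)^4)"

lemma summable_states:
  fixes m :: real
  assumes m: "0 \<le> m"
  shows summable_state1: "summable (T (3*m + 3/2) (1/2) (m + 1/2) (m + 3/2) (m + 1/2))"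
    and summable_state2: "summable (T (3*m + 5/2) (1/2) (m + 3/2) (m + 3/2) (m + 1/2))"
    and summable_state3: "summable (T (3*m + 7/2) (1/2) (m + 3/2) (m + 3/2) (m + 3/2))"
    and Omega_nonneg: "0 \<le> Omega m"
    and Omega_le: "Omega m \<le> K^2 * br (2*m + 1/2) * (br (1/2) * br (m + 1/2)) * V"
proof -
  note R1 = R_state1_le[OF m] and R2 = R_state2_le[OF m] and R3 = R_state3_le[OF m]
  show "summable (T (3*m + 3/2) (1/2) (m + 1/2) (m + 3/2) (m + 1/2))"
    by (rule summable_T(1)[OF _ _ R1]) (use m in \<open>auto intro!: R_nonneg\<close>)
  show "summable (T (3*m + 5/2) (1/2) (m + 3/2) (m + 3/2) (m + 1/2))"
    by (rule summable_T(1)[OF _ _ R2]) (use m in \<open>auto intro!: R_nonneg\<close>)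
  show "summable (T (3*m + 7/2) (1/2) (m + 3/2) (m + 3/2) (m + 3/2))"
    by (rule summable_T(1)[OF _ _ R3]) (use m in \<open>auto intro!: R_nonneg\<close>)
  show "0 \<le> Omega m" unfolding Omega_def
    by (rule summable_T(3)[OF _ _ R1]) (use m in \<open>auto intro!: R_nonneg\<close>)
  have "Omega m \<le> K^2 * br ((3*m + 3/2) - (m + 1/2) - 1/2) * (br (1/2) * br (m + 1/2)) * V"
    unfolding Omega_def V_def
    by (rule summable_T(2)[OF _ _ R1]) (use m in \<open>auto intro!: R_nonneg\<close>)
  then show "Omega m \<le> K^2 * br (2*m + 1/2) * (br (1/2) * br (m + 1/2)) * V"
    by (simp add: algebra_simps)
qed

text \<open>For \<open>m > 0\<close>, \<open>Y m\<close> is \<open>br (3 * m)\<close> times the sum of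
  \<open>T (3*m + 1/2) (1/2) (m + 1/2) (m + 1/2) (m + 1/2)\<close>, with one step of the recursion carried
  out so that it makes sense at \<open>m = 0\<close>, where that series diverges.\<close>

definition Y :: "real \<Rightarrow> real" where
  "Y m = br (2*m) * br (4*m + 1/2)
     + br (m + 1/2)^2 * br (2*m + 1/2)^2 / (br (3*m + 1) * br (2*m + 1)^2) * Omega m"

text \<open>If one step reads \<open>S = (boundary + M * S') / factor\<close>, then
  \<open>tau\<close> collects the boundary terms of the step built into \<open>Y\<close> and of the
  next two steps, each weighted by the multipliers accumulated before it. \<open>rho\<close> is the
  weight left after the third step.\<close>

definition tau :: "real \<Rightarrow> real" where
  "tau m = br (2*m) * br (4*m + 1/2)
     + br (m + 1/2)^2 * br (2*m + 1/2)^2 * br (4*m + 3/2) / (br (3*m + 1)^2 * br (2*m + 1))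
     + br (m + 1/2)^4 * br (2*m + 1/2)^3 * br (2*m + 3/2) * br (4*m + 5/2)
       / (br (3*m + 1)^2 * br (3*m + 2)^2 * br (2*m + 1)^3)"

definition rho :: "real \<Rightarrow> real" where
  "rho m = br (m + 1/2)^6 * br (2*m + 1/2)^3 * br (2*m + 3/2)^3 /
     (br (2*m + 1)^3 * br (2*m + 2)^3 * (br (3*m + 1) * br (3*m + 2) * br (3*m + 3))^2)"

lemma Y_step:
  assumes m: "0 \<le> m"
  shows "Y m = tau m + rho m * Y (m + 1)"
proof -
  note R1 = R_state1_le[OF m] and R2 = R_state2_le[OF m] and R3 = R_state3_le[OF m]
  define S2 where "S2 = suminf (T (3*m + 5/2) (1/2) (m + 3/2) (m + 3/2) (m + 1/2))"
  define S3 where "S3 = suminf (T (3*m + 7/2) (1/2) (m + 3/2) (m + 3/2) (m + 3/2))"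
  have H1: "H (3*m + 3/2) (1/2) (m + 1/2) (m + 3/2) (m + 1/2) \<longlonglongrightarrow> 0"
    by (rule H_tendsto_0[OF _ R1]) (use m in \<open>auto intro!: R_nonneg\<close>)
  have H2: "H (3*m + 5/2) (1/2) (m + 3/2) (m + 3/2) (m + 1/2) \<longlonglongrightarrow> 0"
    by (rule H_tendsto_0[OF _ R2]) (use m in \<open>auto intro!: R_nonneg\<close>)
  have H3: "H (3*m + 7/2) (1/2) (m + 3/2) (m + 3/2) (m + 3/2) \<longlonglongrightarrow> 0"
    by (rule H_tendsto_0[OF _ R3]) (use m in \<open>auto intro!: R_nonneg\<close>)
  have eq1: "3*m + 3/2 + 1 = 3*m + 5/2" "m + 1/2 + 1 = m + 3/2"
     "1 + 2*(3*m + 3/2) - 1/2 - (m + 1/2) - (m + 3/2) - (m + 1/2) = 3*m + 1"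
     "3*m + 3/2 - (m + 1/2) = 2*m + 1" "1 + 2*(3*m + 3/2) - 1/2 - (m + 1/2) - (m + 3/2) = 4*m + 3/2"
     "1 + (3*m + 3/2) - 1/2 - (m + 1/2) = 2*m + 3/2" "1 + (3*m + 3/2) - 1/2 - (m + 3/2) = 2*m + 1/2"
     "1 + (3*m + 3/2) - (m + 1/2) - (m + 3/2) = m + 1/2" "1 + (3*m + 3/2) - 1/2 = 3*m + 2"
     "1 + (3*m + 3/2) - (m + 1/2) = 2*m + 2" "1 + (3*m + 3/2) - (m + 3/2) = 2*m + 1"
    by auto
  \<comment> \<open>The recurrence raises only its last entry; symmetry of the summand lets another
    entry take that place at the next step.\<close>
  have T2: "T (3*m + 5/2) (1/2) (m + 1/2) (m + 3/2) (m + 3/2)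
      = T (3*m + 5/2) (1/2) (m + 3/2) (m + 3/2) (m + 1/2)"
    by (metis T_commute)
  have E1: "br (3*m + 1) * Omega m = br (2*m + 1) * br (4*m + 3/2)
     + br (m + 1/2) * br (2*m + 3/2) * br (2*m + 1/2) * br (m + 1/2)
       / (br (3*m + 2) * br (2*m + 2) * br (2*m + 1)) * S2"
    using suminf_T_shift[of "1/2" "3*m + 3/2" "m + 1/2" "m + 3/2" "m + 1/2", OF _ _ _ _ _ _ _ H1,
        unfolded M_def eq1 T2, OF _ _ _ _ _ summable_state1[OF m] summable_state2[OF m]] m
    by (simp add: Omega_def S2_def)
  have eq2: "3*m + 5/2 + 1 = 3*m + 7/2" "m + 1/2 + 1 = m + 3/2"
     "1 + 2*(3*m + 5/2) - 1/2 - (m + 3/2) - (m + 3/2) - (m + 1/2) = 3*m + 2"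
     "3*m + 5/2 - (m + 1/2) = 2*m + 2" "1 + 2*(3*m + 5/2) - 1/2 - (m + 3/2) - (m + 3/2) = 4*m + 5/2"
     "1 + (3*m + 5/2) - 1/2 - (m + 3/2) = 2*m + 3/2"
     "1 + (3*m + 5/2) - (m + 3/2) - (m + 3/2) = m + 1/2" "1 + (3*m + 5/2) - 1/2 = 3*m + 3"
     "1 + (3*m + 5/2) - (m + 3/2) = 2*m + 2"
    by auto
  have E2: "br (3*m + 2) * S2 = br (2*m + 2) * br (4*m + 5/2)
     + br (m + 1/2) * br (2*m + 3/2) * br (2*m + 3/2) * br (m + 1/2)
       / (br (3*m + 3) * br (2*m + 2) * br (2*m + 2)) * S3"
    using suminf_T_shift[of "1/2" "3*m + 5/2" "m + 3/2" "m + 3/2" "m + 1/2", OF _ _ _ _ _ _ _ H2,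
        unfolded M_def eq2, OF _ _ _ _ _ summable_state2[OF m] summable_state3[OF m]] m
    by (simp add: S2_def S3_def)
  have m1: "0 \<le> m + 1" using m by simp
  have eq3: "3*m + 7/2 + 1 = 3*(m + 1) + 3/2" "m + 3/2 + 1 = m + 1 + 3/2"
     "1 + 2*(3*m + 7/2) - 1/2 - (m + 3/2) - (m + 3/2) - (m + 3/2) = 3*m + 3"
     "3*m + 7/2 - (m + 3/2) = 2*(m + 1)"
     "1 + 2*(3*m + 7/2) - 1/2 - (m + 3/2) - (m + 3/2) = 4*(m + 1) + 1/2"
     "1 + (3*m + 7/2) - 1/2 - (m + 3/2) = 2*(m + 1) + 1/2"
     "1 + (3*m + 7/2) - (m + 3/2) - (m + 3/2) = m + 1 + 1/2" "1 + (3*m + 7/2) - 1/2 = 3*(m + 1) + 1"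
     "1 + (3*m + 7/2) - (m + 3/2) = 2*(m + 1) + 1"
    by auto
  have T3: "T (3*(m+1) + 3/2) (1/2) (m + 3/2) (m + 3/2) (m + 1 + 3/2)
      = T (3*(m+1) + 3/2) (1/2) (m + 1 + 1/2) (m + 1 + 3/2) (m + 1 + 1/2)"
  proof -
    have "m + 1 + 1/2 = m + 3/2" by simp
    then show ?thesis by (simp only: T_commute(1)[of _ _ "m + 3/2" "m + 3/2"])
  qed
  have m3: "m + 1 + 1/2 = m + 3/2" by simp
  \<comment> \<open>The parameters of \<open>S3\<close> are those of the starting series at
    \<open>m + 1\<close>, so this step is literally the regularisation that defines
    \<open>Y (m + 1)\<close>, and its boundary term belongs to the next index.\<close>
  have E3: "br (3*m + 3) * S3 = Y (m + 1)"
    using suminf_T_shift[of "1/2" "3*m + 7/2" "m + 3/2" "m + 3/2" "m + 3/2", OF _ _ _ _ _ _ _ H3,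
        unfolded M_def eq3 T3, OF _ _ _ _ _ summable_state3[OF m] summable_state1[OF m1]] m
    by (simp add: S3_def Y_def Omega_def m3 power2_eq_square mult_ac add_ac)
  have nz: "br (3*m + 1) \<noteq> 0" "br (3*m + 2) \<noteq> 0" "br (3*m + 3) \<noteq> 0" "br (2*m + 1) \<noteq> 0" "br (2*m + 2) \<noteq> 0"
    using m by (auto intro!: br_pos less_imp_neq[symmetric])
  have S3: "S3 = Y (m + 1) / br (3*m + 3)" using E3 nz by (simp add: field_simps)
  have S2: "S2 = (br (2*m + 2) * br (4*m + 5/2)
     + br (m + 1/2) * br (2*m + 3/2) * br (2*m + 3/2) * br (m + 1/2)
       / (br (3*m + 3) * br (2*m + 2) * br (2*m + 2)) * S3) / br (3*m + 2)"
    using E2 nz by (metis nonzero_mult_div_cancel_left)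
  have O: "Omega m = (br (2*m + 1) * br (4*m + 3/2)
     + br (m + 1/2) * br (2*m + 3/2) * br (2*m + 1/2) * br (m + 1/2)
       / (br (3*m + 2) * br (2*m + 2) * br (2*m + 1)) * S2) / br (3*m + 1)"
    using E1 nz by (metis nonzero_mult_div_cancel_left)
  show ?thesis
    unfolding Y_def[of m] tau_def rho_def O S2 S3 using nz
    by (simp add: divide_simps) (simp add: eval_nat_numeral algebra_simps)
qed

section \<open>Evaluation at n = 0\<close>

text \<open>Here \<open>e = a\<close>, a relation preserved when both are raised, so every step
  along this chain is a pure product. \<open>Z 0\<close> is \<open>Omega 0\<close> up to the order
  of the entries.\<close>

definition Z :: "real \<Rightarrow> real" where
  "Z m = suminf (T (m + 3/2) (1/2) (1/2) (1/2) (m + 3/2))"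

lemma R_chain_nonneg: "0 \<le> m \<Longrightarrow> 0 \<le> R (m + 3/2) (1/2) (1/2) (1/2) (m + 3/2) k"
  by (intro R_nonneg) auto

text \<open>The bound \<open>X\<close> is left free because two rates are needed: a gap of 1/2
  suffices for \<open>H\<close> to vanish, while summing \<open>T\<close> for \<open>m >= 1\<close>
  uses a gap of 1.\<close>

lemma R_chain_le:
  assumes m: "0 \<le> m" and X: "rp (3/2) k / rp (m + 2) k \<le> X"
  shows "R (m + 3/2) (1/2) (1/2) (1/2) (m + 3/2) k \<le> (br (1/2) / br (1/2 + real k))^2 * X^2"
proof -
  have "R (m + 3/2) (1/2) (1/2) (1/2) (m + 3/2) k =
      (rp (1/2) k / rp (m + 2) k) ^ 2 * ((rp (1/2) k / rp 1 k) * (rp (m + 3/2) k / rp (m + 2) k))"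
    unfolding R_def by (simp add: power2_eq_square algebra_simps)
  also have "rp (1/2) k / rp (m + 2) k = br (1/2) / br (1/2 + real k) * (rp (3/2) k / rp (m + 2) k)"
    using rp_ratio_split[of "1/2" k "m + 2"] by simp
  also have "(br (1/2) / br (1/2 + real k) * (rp (3/2) k / rp (m + 2) k))^2 *
        ((rp (1/2) k / rp 1 k) * (rp (m + 3/2) k / rp (m + 2) k))
     \<le> (br (1/2) / br (1/2 + real k) * X)^2 * (1 * 1)"
    using m by (intro mult_mono power_mono X rp_ratio_le_1 rp_ratio_nonneg mult_nonneg_nonneg
        divide_nonneg_nonneg br_nonneg order_trans[OF _ X]) auto
  finally show ?thesis by (simp add: power_mult_distrib power_divide)
qed

text \<open>\<open>H_tendsto_0\<close> asks for \<open>e + 1 <= a\<close> and does not cover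
  \<open>e = a\<close>. Here the factor \<open>br (a - e + k)\<close> is just \<open>br k\<close>,
  at most \<open>br (1/2 + k)\<close>, and decay of order 1/k is enough.\<close>

lemma H_chain_tendsto_0:
  assumes m: "0 \<le> m"
  shows "H (m + 3/2) (1/2) (1/2) (1/2) (m + 3/2) \<longlonglongrightarrow> 0"
proof (rule tendsto_sandwich)
  let ?H = "H (m + 3/2) (1/2) (1/2) (1/2) (m + 3/2)"
  let ?C = "K * br (2*m + 2) * br (1/2)^2"
  show "\<forall>\<^sub>F k in sequentially. 0 \<le> ?H k"
    unfolding H_def using m
    by (intro always_eventually allI mult_nonneg_nonneg br_nonneg R_chain_nonneg) auto
  have "?H k \<le> ?C * ((3/2) / (3/2 + real k))" for k
  proof -
    have nz: "0 < br (1/2 + real k)" by (intro br_pos) auto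
    have X: "rp (3/2) k / rp (m + 2) k \<le> hrp (3/2) k"
      using m by (intro rp_ratio_le_hrp) auto
    have "br (m + 3/2 - (m + 3/2) + real k) \<le> br (1/2 + real k)" by (intro br_mono0) auto
    moreover have "br (1 + 2 * (m + 3/2) - 1/2 - 1/2 - 1/2 + real k) \<le> K * br (1/2 + real k) * br (2*m + 2)"
      using br_add_le[of "1/2 + real k" "2*m + 2"] m by (simp add: algebra_simps)
    ultimately have "?H k \<le> br (1/2 + real k) * (K * br (1/2 + real k) * br (2*m + 2)) *
       ((br (1/2) / br (1/2 + real k))^2 * (hrp (3/2) k)^2)"
      unfolding H_def using m K_pos
      by (intro mult_mono R_chain_nonneg R_chain_le X mult_nonneg_nonneg br_nonneg) auto
    also have "\<dots> = ?C * (hrp (3/2) k)^2" using nz by (simp add: power_divide power2_eq_square)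
    also have "\<dots> \<le> ?C * ((3/2) / (3/2 + real k))"
      using m K_pos by (intro mult_left_mono hrp_square_le mult_nonneg_nonneg br_nonneg) auto
    finally show ?thesis .
  qed
  then show "\<forall>\<^sub>F k in sequentially. ?H k \<le> ?C * ((3/2) / (3/2 + real k))" by simp
  show "(\<lambda>k. ?C * ((3/2) / (3/2 + real k))) \<longlonglongrightarrow> 0"
    by (intro tendsto_mult_right_zero real_tendsto_divide_at_top[of _ "3/2"] tendsto_const
       filterlim_tendsto_add_at_top[OF tendsto_const filterlim_real_sequentially])
qed auto

text \<open>Separating the initial factor of the ratio yields \<open>(3/2) / (m + 2)\<close>,
  squared in the bound; relative to the term at 0, which is \<open>br (m + 3/2)\<close>, the tail
  therefore vanishes as \<open>m\<close> grows.\<close>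

lemma T_chain_Suc_le:
  assumes m: "1 \<le> m"
  shows "T (m + 3/2) (1/2) (1/2) (1/2) (m + 3/2) (Suc k) \<le>
    br (m + 3/2) * (K^2 * br (1/2)^2 * ((3/2) / (m + 2))^2) * (((5/2) / (5/2 + real k))^2)"
proof -
  \<comment> \<open>With a gap of exactly 1 the majorant product telescopes.\<close>
  have e: "(\<Prod>j<k. (5/2 + real j) / (7/2 + real j)) = (5/2) / (5/2 + real k)"
  proof (induction k)
    case (Suc k)
    define x where "x = 5/2 + real k"
    have "0 < x" "7/2 + real k = x + 1" "5/2 + real (Suc k) = x + 1" by (auto simp: x_def)
    then show ?case by (subst prod.lessThan_Suc, subst Suc) (simp add: x_def[symmetric])
  qed simp
  have "rp (3/2) (Suc k) / rp (m + 2) (Suc k) = br (3/2) / br (m + 2) * (rp (5/2) k / rp (m + 3) k)"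
    unfolding rp_Suc' by (simp add: algebra_simps)
  also have "\<dots> \<le> (3/2) / (m + 2) * (\<Prod>j<k. (5/2 + real j) / (7/2 + real j))"
    using m by (intro mult_mono br_ratio_le rp_ratio_le rp_ratio_nonneg divide_nonneg_nonneg frac_le) auto
  finally have X: "rp (3/2) (Suc k) / rp (m + 2) (Suc k) \<le> (3/2) / (m + 2) * ((5/2) / (5/2 + real k))"
    unfolding e .
  have nz: "0 < br (1/2 + real (Suc k))" by (intro br_pos) auto
  have "br (m + 3/2 + 2 * real (Suc k)) \<le> K^2 * br (1/2 + real (Suc k)) * br (1/2 + real (Suc k)) * br (m + 1/2)"
    using br_add_le3[of "1/2 + real (Suc k)" "1/2 + real (Suc k)" "m + 1/2"] m by (simp add: algebra_simps)
  also have "\<dots> \<le> K^2 * br (1/2 + real (Suc k)) * br (1/2 + real (Suc k)) * br (m + 3/2)"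
    using m by (intro mult_left_mono br_mono mult_nonneg_nonneg br_nonneg) auto
  finally have "T (m + 3/2) (1/2) (1/2) (1/2) (m + 3/2) (Suc k) \<le>
     (K^2 * br (1/2 + real (Suc k)) * br (1/2 + real (Suc k)) * br (m + 3/2)) *
     ((br (1/2) / br (1/2 + real (Suc k)))^2 * ((3/2) / (m + 2) * ((5/2) / (5/2 + real k)))^2)"
    unfolding T_def using m X
    by (intro mult_mono R_chain_nonneg R_chain_le mult_nonneg_nonneg br_nonneg) auto
  also have "\<dots> = br (m + 3/2) * (K^2 * br (1/2)^2 * ((3/2) / (m + 2))^2) * (((5/2) / (5/2 + real k))^2)"
    using nz by (simp add: power_divide power_mult_distrib) (simp add: power2_eq_square mult_ac)
  finally show ?thesis .
qed

lemma T_chain_nonneg: "0 \<le> m \<Longrightarrow> 0 \<le> T (m + 3/2) (1/2) (1/2) (1/2) (m + 3/2) k"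
  unfolding T_def by (intro mult_nonneg_nonneg br_nonneg R_chain_nonneg) auto

lemma summable_chain_ge_1:
  assumes m: "1 \<le> m" shows "summable (T (m + 3/2) (1/2) (1/2) (1/2) (m + 3/2))"
proof -
  have "summable (\<lambda>k. T (m + 3/2) (1/2) (1/2) (1/2) (m + 3/2) (Suc k))"
    by (rule summable_comparison_test'[OF summable_mult[OF summable_shifted_inverse_squares[of "5/2"]], of 0])
      (use m T_chain_Suc_le[OF m] T_chain_nonneg[of m] in auto)
  then show ?thesis by (simp only: summable_Suc_iff)
qed

lemma T_chain_0: "T (0 + 3/2) (1/2) (1/2) (1/2) (0 + 3/2) = T (3*0 + 3/2) (1/2) (0 + 1/2) (0 + 3/2) (0 + 1/2)"
  by (simp only: T_commute(1)[of _ _ _ "0 + 3/2"]) simp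

text \<open>At \<open>n = 0\<close> the gap between \<open>3/2\<close> and \<open>n + 2\<close> is
  only 1/2 and the chain estimate is too weak, but there the series is one of the states already
  treated.\<close>

lemma summable_chain: "summable (T (real n + 3/2) (1/2) (1/2) (1/2) (real n + 3/2))"
proof (cases n)
  case 0
  then show ?thesis using summable_state1[of 0] T_chain_0 by simp
next
  case (Suc l)
  then show ?thesis by (intro summable_chain_ge_1) simp
qed

lemma Z_step:
  "Z (real n) = br (real n + 3/2)^4 / (br (real n + 1) * br (real n + 2)^3) * Z (real (Suc n))"
proof -
  let ?m = "real n"
  have eq: "?m + 3/2 + 1 = real (Suc n) + 3/2" "1 + 2*(?m + 3/2) - 1/2 - 1/2 - 1/2 - (?m + 3/2) = ?m + 1"
    "1 + (?m + 3/2) - 1/2 - 1/2 = ?m + 3/2" "1 + (?m + 3/2) - 1/2 = ?m + 2" "?m + 3/2 - (?m + 3/2) = 0"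
    by auto
  have "br (?m + 1) * Z ?m = br (?m + 3/2)^4 / br (?m + 2)^3 * Z (real (Suc n))"
    using suminf_T_shift[of "1/2" "?m + 3/2" "1/2" "1/2" "?m + 3/2", OF _ _ _ _ _ _ _ H_chain_tendsto_0,
      unfolded M_def eq, OF _ _ _ _ _ summable_chain summable_chain]
    by (simp add: Z_def br_0 eval_nat_numeral mult_ac add_ac)
  moreover have "br (?m + 1) \<noteq> 0" by (auto intro!: br_pos less_imp_neq[symmetric])
  ultimately show ?thesis by (metis divide_divide_eq_left mult.commute nonzero_mult_div_cancel_left times_divide_eq_left)
qed

lemma Z_0: "Z 0 = rp (3/2) n ^ 4 / (rp 1 n * rp 2 n ^ 3) * Z (real n)"
proof (induction n)
  case (Suc n)
  show ?case
    by (subst Suc, subst Z_step) (simp add: rp_Suc power_mult_distrib add_ac mult_ac)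
qed simp

text \<open>The term at 0 equals \<open>br (n + 3/2)\<close>, and the remaining terms add at most a
  multiple of 1 / (n + 2)^2 of it.\<close>

lemma Z_tendsto: "(\<lambda>n. Z (real n) / br (real n + 3/2)) \<longlonglongrightarrow> 1"
proof (rule tendsto_sandwich)
  define S where "S = (\<Sum>k. ((5/2) / (5/2 + real k))^2 :: real)"
  define C where "C = K^2 * br (1/2)^2"
  have "Z (real n) / br (real n + 3/2) \<le> 1 + C * ((3/2) / (real n + 2))^2 * S
     \<and> 1 \<le> Z (real n) / br (real n + 3/2)" if n: "1 \<le> n" for n
  proof -
    let ?T = "T (real n + 3/2) (1/2) (1/2) (1/2) (real n + 3/2)"
    define B where "B = br (real n + 3/2) * (C * ((3/2) / (real n + 2))^2)"
    have n': "1 \<le> real n" using n by simp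
    have Bp: "0 < br (real n + 3/2)" by (intro br_pos) auto
    have s: "summable (\<lambda>k. ?T (Suc k))" using summable_chain[of n] by (simp only: summable_Suc_iff)
    have "Z (real n) = (\<Sum>k. ?T (Suc k)) + ?T 0"
      unfolding Z_def using suminf_split_head[OF summable_chain[of n]] by linarith
    moreover have "?T 0 = br (real n + 3/2)" by (simp add: T_def R_def)
    moreover have "(\<Sum>k. ?T (Suc k)) \<le> (\<Sum>k. B * ((5/2) / (5/2 + real k))^2)"
      unfolding B_def C_def by (intro suminf_le s T_chain_Suc_le n' summable_mult summable_shifted_inverse_squares) simp
    moreover have "(\<Sum>k. B * ((5/2) / (5/2 + real k))^2) = B * S"
      unfolding S_def by (intro suminf_mult summable_shifted_inverse_squares) simp
    moreover have "0 \<le> (\<Sum>k. ?T (Suc k))" by (intro suminf_nonneg s T_chain_nonneg) simp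
    ultimately have "Z (real n) \<le> br (real n + 3/2) * (1 + C * ((3/2) / (real n + 2))^2 * S)"
      "br (real n + 3/2) \<le> Z (real n)"
      by (simp_all add: B_def distrib_left)
    then show ?thesis using Bp by (simp add: pos_divide_le_eq pos_le_divide_eq mult.commute)
  qed
  then show "\<forall>\<^sub>F n in sequentially. 1 \<le> Z (real n) / br (real n + 3/2)"
    "\<forall>\<^sub>F n in sequentially. Z (real n) / br (real n + 3/2) \<le> 1 + C * ((3/2) / (real n + 2))^2 * S"
    by (auto intro: eventually_sequentiallyI[of 1])
  have "(\<lambda>n. (3/2) / (2 + real n)) \<longlonglongrightarrow> 0"
    by (intro real_tendsto_divide_at_top[of _ "3/2"] tendsto_const
       filterlim_tendsto_add_at_top[OF tendsto_const filterlim_real_sequentially])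
  then have "(\<lambda>n. (3/2) / (real n + 2)) \<longlonglongrightarrow> 0" by (simp only: add.commute)
  then have "(\<lambda>n. 1 + C * ((3/2) / (real n + 2))^2 * S) \<longlonglongrightarrow> 1 + C * 0^2 * S"
    by (intro tendsto_intros)
  then show "(\<lambda>n. 1 + C * ((3/2) / (real n + 2))^2 * S) \<longlonglongrightarrow> 1" by simp
qed auto

text \<open>Since \<open>br 0 = 0\<close>, \<open>Y 0\<close> is a multiple of
  \<open>Omega 0 = Z 0\<close>. Iterating the chain leaves a finite product times
  \<open>Z n\<close>, and \<open>Z n\<close> may be replaced by \<open>br (n + 3/2)\<close> in the
  limit.\<close>

lemma Y_0_tendsto:
  "(\<lambda>n. (rp (1/2) n / rp 1 n)^4 * br (real n) * br (real n + 1/2)) \<longlonglongrightarrow> Y 0"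
proof -
  have Y0: "Y 0 = (rp (1/2) (Suc n) / rp 1 (Suc n))^4 * br (real n + 1) * Z (real n)" for n
  proof -
    have "Omega 0 = Z 0" unfolding Omega_def Z_def T_chain_0 ..
    then have "Y 0 = br (1/2)^4 / br 1 ^3 * Z 0"
      by (simp add: Y_def br_0 eval_nat_numeral mult_ac)
    also have "\<dots> = br (1/2)^4 / br 1 ^3 * (rp (3/2) n ^ 4 / (rp 1 n * rp 2 n ^ 3) * Z (real n))"
      by (subst Z_0[of n]) simp
    also have "\<dots> = (br (1/2) * rp (3/2) n)^4 / (rp 1 n * (br 1 * rp 2 n)^3) * Z (real n)"
      by (simp add: power_mult_distrib mult_ac)
    also have "br (1/2) * rp (3/2) n = rp (1/2) (Suc n)" by (simp add: rp_Suc')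
    also have "br 1 * rp 2 n = rp 1 (Suc n)" by (simp add: rp_Suc')
    also have "rp 1 n = rp 1 (Suc n) / br (real n + 1)"
      using br_pos[of "real n + 1"] by (simp add: rp_Suc add_ac)
    finally show ?thesis by (simp add: power_divide eval_nat_numeral)
  qed
  have "(\<lambda>n. Y 0 / (Z (real n) / br (real n + 3/2))) \<longlonglongrightarrow> Y 0 / 1"
    by (intro tendsto_divide tendsto_const Z_tendsto) simp
  moreover have "\<forall>\<^sub>F n in sequentially. Y 0 / (Z (real n) / br (real n + 3/2)) =
     (rp (1/2) (Suc n) / rp 1 (Suc n))^4 * br (real (Suc n)) * br (real (Suc n) + 1/2)"
    using order_tendstoD(1)[OF Z_tendsto, of 0, simplified]
  proof eventually_elim
    case (elim n)
    then have "Z (real n) \<noteq> 0" by auto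
    then show ?case by (subst Y0[of n]) (simp add: add_ac)
  qed
  ultimately have "(\<lambda>n. (rp (1/2) (Suc n) / rp 1 (Suc n))^4 * br (real (Suc n)) * br (real (Suc n) + 1/2)) \<longlonglongrightarrow> Y 0"
    by (simp add: filterlim_cong)
  then show ?thesis by (subst (asm) filterlim_sequentially_Suc)
qed

section \<open>The sum over n\<close>

definition D :: "nat \<Rightarrow> real" where
  "D n = rp (1/2) n ^ 6 * rp (1/2) (2*n) ^ 3 / (rp 1 (2*n) ^ 3 * rp 1 (3*n) ^ 2)"

lemma D_nonneg: "0 \<le> D n"
  unfolding D_def by (intro divide_nonneg_nonneg mult_nonneg_nonneg zero_le_power less_imp_le rp_pos) auto

lemma D_Suc: "D (Suc n) = D n * rho (real n)"
proof -
  have 2: "rp x (2 * Suc n) = rp x (2*n) * br (2 * real n + x) * br (2 * real n + (x + 1))" for x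
    by (simp add: rp_Suc add_ac)
  have 3: "rp 1 (3 * Suc n) = rp 1 (3*n) * br (3 * real n + 1) * br (3 * real n + 2) * br (3 * real n + 3)"
    by (simp add: rp_Suc eval_nat_numeral add_ac)
  show ?thesis unfolding D_def rho_def 2 3 rp_Suc
    by (simp add: power_mult_distrib add_ac mult_ac)
qed

lemma Y_nonneg: "0 \<le> m \<Longrightarrow> 0 \<le> Y m"
  unfolding Y_def by (intro add_nonneg_nonneg mult_nonneg_nonneg divide_nonneg_nonneg br_nonneg
      zero_le_power Omega_nonneg) auto

lemma V_nonneg: "0 \<le> V"
  unfolding V_def by (intro suminf_nonneg summable_hrp_power4) auto

text \<open>The growth found is of order p^6 with p = \<open>br (m + 1/2)\<close>. It is rounded up
  to eight brackets, the form that \<open>D_le\<close> absorbs; as p may be less than 1, raising the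
  exponent costs powers of \<open>br (1/2)\<close>, a lower bound for p.\<close>

lemma Y_le:
  assumes m: "0 \<le> m"
  shows "Y m \<le> (K^4 / br (1/2)^2 + K^3 * V / br (1/2)^3) * (br (m + 1/2)^4 * br (m + 3/2)^4)"
proof -
  define p where "p = br (m + 1/2)"
  define s where "s = br (1/2)"
  have s: "0 < s" by (simp add: s_def br_pos)
  have sp: "s \<le> p" unfolding s_def p_def using m by (intro br_mono) auto
  have p: "0 < p" using s sp by simp
  have b1: "br (2*m + 1) \<le> K * p^2"
    using br_add_le[of "m + 1/2" "m + 1/2"] m by (simp add: p_def power2_eq_square algebra_simps)
  have b0: "br (2*m) \<le> K * p^2" using br_mono0[of "2*m" "2*m+1"] m b1 by simp
  have b2: "br (2*m + 1/2) \<le> K * p^2" using br_mono0[of "2*m+1/2" "2*m+1"] m b1 by simp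
  have "br (4*m + 1/2) \<le> br (4*m + 2)" using m by (intro br_mono) auto
  also have "\<dots> \<le> K * br (2*m + 1) * br (2*m + 1)"
    using br_add_le[of "2*m + 1" "2*m + 1"] m by (simp add: algebra_simps)
  also have "\<dots> \<le> K * (K * p^2) * (K * p^2)"
    using K_pos p m b1 by (intro mult_mono mult_left_mono) (auto intro!: br_nonneg mult_nonneg_nonneg)
  finally have b4: "br (4*m + 1/2) \<le> K * (K * p^2) * (K * p^2)" .
  have t1: "br (2*m) * br (4*m + 1/2) \<le> (K * p^2) * (K * (K * p^2) * (K * p^2))"
    using b0 b4 m K_pos p by (intro mult_mono br_nonneg) auto
  have "Omega m \<le> K^2 * br (2*m + 1/2) * (s * p) * V" using Omega_le[OF m] by (simp add: s_def p_def)
  also have "\<dots> \<le> K^2 * (K * p^2) * (s * p) * V"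
    using b2 s p V_nonneg by (intro mult_right_mono mult_left_mono) auto
  finally have t2: "Omega m \<le> K^2 * (K * p^2) * (s * p) * V" .
  have "p^2 * br (2*m + 1/2)^2 / (br (3*m + 1) * br (2*m + 1)^2)
     = p^2 * (br (2*m + 1/2) / br (2*m + 1))^2 / br (3*m + 1)" by (simp add: power_divide)
  also have "\<dots> \<le> p^2 * 1^2 / s"
  proof -
    have "br (2*m + 1/2) / br (2*m + 1) \<le> 1"
      using br_mono[of "2*m+1/2" "2*m+1"] br_pos[of "2*m+1"] m by simp
    moreover have "0 \<le> br (2*m + 1/2) / br (2*m + 1)"
      using m by (intro divide_nonneg_nonneg br_nonneg) auto
    moreover have "s \<le> br (3*m + 1)" unfolding s_def using m by (intro br_mono) auto
    ultimately show ?thesis using s p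
      by (intro frac_le mult_left_mono power_mono) auto
  qed
  finally have t3: "p^2 * br (2*m + 1/2)^2 / (br (3*m + 1) * br (2*m + 1)^2) \<le> p^2 / s" by simp
  have "Y m \<le> (K * p^2) * (K * (K * p^2) * (K * p^2)) + p^2 / s * (K^2 * (K * p^2) * (s * p) * V)"
    unfolding Y_def p_def[symmetric] using s p
    by (intro add_mono t1 mult_mono t2 t3 Omega_nonneg m) auto
  also have "\<dots> = K^4 * p^6 + K^3 * V * p^5" using s by (simp add: eval_nat_numeral algebra_simps)
  also have "\<dots> \<le> K^4 * (p^8 / s^2) + K^3 * V * (p^8 / s^3)"
  proof (intro add_mono mult_left_mono)
    have "p^6 * s^2 \<le> p^6 * p^2" using s sp by (intro mult_left_mono power_mono) auto
    then show "p^6 \<le> p^8 / s^2" using s by (simp add: field_simps flip: power_add)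
    have "p^5 * s^3 \<le> p^5 * p^3" using s sp by (intro mult_left_mono power_mono) auto
    then show "p^5 \<le> p^8 / s^3" using s by (simp add: field_simps flip: power_add)
  qed (use K_pos V_nonneg in auto)
  also have "\<dots> = (K^4 / s^2 + K^3 * V / s^3) * p^8" by (simp add: algebra_simps)
  also have "\<dots> \<le> (K^4 / s^2 + K^3 * V / s^3) * (p^4 * br (m + 3/2)^4)"
  proof (rule mult_left_mono)
    have "p \<le> br (m + 3/2)" unfolding p_def using m by (intro br_mono) auto
    then have "p^4 * p^4 \<le> p^4 * br (m + 3/2)^4" using p by (intro mult_left_mono power_mono) auto
    then show "p^8 \<le> p^4 * br (m + 3/2)^4" by (simp flip: power_add)
  qed (use K_pos V_nonneg s in auto)
  finally show ?thesis by (simp add: p_def s_def)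
qed

text \<open>Four of the six factors \<open>rp (1/2) n\<close> absorb the eight brackets and become
  \<open>rp (5/2) n\<close>. The other two, against \<open>rp 1 n\<close>, supply the decay of order
  1/n.\<close>

lemma D_le:
  assumes n: "2 \<le> n"
  shows "D n * (br (real n + 1/2)^4 * br (real n + 3/2)^4) \<le> (br (1/2) * br (3/2))^4 * ((1/2) / (1/2 + real n))"
proof -
  have a: "rp (1/2) n * br (real n + 1/2) * br (real n + 3/2) = br (1/2) * br (3/2) * rp (5/2) n"
  proof -
    have "rp (1/2) (Suc (Suc n)) = rp (1/2) n * br (real n + 1/2) * br (real n + 3/2)"
      by (subst rp_Suc, subst rp_Suc) (simp add: add_ac)
    moreover have "rp (1/2) (Suc (Suc n)) = br (1/2) * br (3/2) * rp (5/2) n"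
      by (subst rp_Suc', subst rp_Suc') simp
    ultimately show ?thesis by simp
  qed
  \<comment> \<open>Three blocks of length \<open>n\<close>, squared, provide one denominator for
    each of the six factors \<open>rp (1/2) n\<close>.\<close>
  have b: "rp 1 (3*n) = rp 1 n * rp (1 + real n) n * rp (1 + 2 * real n) n"
  proof -
    have "3 * n = n + n + n" by simp
    then show ?thesis by (simp only: rp_add) (simp add: algebra_simps)
  qed
  have "D n * (br (real n + 1/2)^4 * br (real n + 3/2)^4)
     = rp (1/2) n ^ 2 * (rp (1/2) n * br (real n + 1/2) * br (real n + 3/2))^4 * rp (1/2) (2*n) ^ 3
        / (rp 1 (2*n) ^ 3 * rp 1 (3*n) ^ 2)"
    unfolding D_def by (simp add: power_mult_distrib)
  also have "\<dots> = (br (1/2) * br (3/2))^4 * ((rp (1/2) n / rp 1 n)^2 * (rp (5/2) n / rp (1 + real n) n)^2 *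
      (rp (5/2) n / rp (1 + 2 * real n) n)^2 * (rp (1/2) (2*n) / rp 1 (2*n))^3)"
    unfolding a b by (simp add: power_mult_distrib power_divide mult_ac)
  \<comment> \<open>\<open>2 <= n\<close> ensures \<open>5/2 <= 1 + n\<close>, so the ratios with
    numerator \<open>rp (5/2) n\<close> are at most 1.\<close>
  also have "\<dots> \<le> (br (1/2) * br (3/2))^4 * ((hrp (1/2) n)^2 * 1^2 * 1^2 * 1^3)"
    using n by (intro mult_left_mono mult_mono power_mono rp_ratio_le_1 rp_ratio_nonneg
        mult_nonneg_nonneg zero_le_power br_nonneg rp_ratio_le_hrp hrp_nonneg) auto
  also have "\<dots> \<le> (br (1/2) * br (3/2))^4 * ((1/2) / (1/2 + real n))"
    using hrp_square_le[of "1/2" n] by (intro mult_left_mono) auto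
  finally show ?thesis .
qed

lemma D_Y_tendsto_0: "(\<lambda>n. D n * Y (real n)) \<longlonglongrightarrow> 0"
proof (rule tendsto_sandwich)
  define C where "C = K^4 / br (1/2)^2 + K^3 * V / br (1/2)^3"
  have C: "0 \<le> C" unfolding C_def using K_pos V_nonneg
    by (intro add_nonneg_nonneg divide_nonneg_nonneg mult_nonneg_nonneg zero_le_power br_nonneg) auto
  let ?f = "\<lambda>n. C * ((br (1/2) * br (3/2))^4 * ((1/2) / (1/2 + real n)))"
  show "\<forall>\<^sub>F n in sequentially. 0 \<le> D n * Y (real n)"
    by (intro always_eventually allI mult_nonneg_nonneg D_nonneg Y_nonneg) auto
  have "D n * Y (real n) \<le> ?f n" if "2 \<le> n" for n
  proof -
    have "D n * Y (real n) \<le> D n * (C * (br (real n + 1/2)^4 * br (real n + 3/2)^4))"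
      unfolding C_def by (intro mult_left_mono Y_le D_nonneg) auto
    also have "\<dots> = C * (D n * (br (real n + 1/2)^4 * br (real n + 3/2)^4))" by simp
    also have "\<dots> \<le> ?f n" by (intro mult_left_mono D_le that C)
    finally show ?thesis .
  qed
  then show "\<forall>\<^sub>F n in sequentially. D n * Y (real n) \<le> ?f n"
    by (auto intro: eventually_sequentiallyI)
  show "?f \<longlonglongrightarrow> 0"
    by (intro tendsto_mult_right_zero real_tendsto_divide_at_top[of _ "1/2"] tendsto_const
       filterlim_tendsto_add_at_top[OF tendsto_const filterlim_real_sequentially])
qed auto

theorem D_tau_sums: "(\<lambda>n. D n * tau (real n)) sums Y 0"
proof -
  have "D n * tau (real n) = D n * Y (real n) - D (Suc n) * Y (real (Suc n))" for n
    unfolding D_Suc using Y_step[of "real n"] by (simp add: algebra_simps)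
  moreover have "(\<lambda>n. D n * Y (real n) - D (Suc n) * Y (real (Suc n))) sums (D 0 * Y (real 0) - 0)"
    by (rule telescope_sums'[OF D_Y_tendsto_0])
  moreover have "D 0 = 1" by (simp add: D_def)
  ultimately show ?thesis by simp
qed

end

section \<open>The two brackets\<close>

definition qbr :: "real \<Rightarrow> real \<Rightarrow> real" where
  "qbr q x = q powr (- x / 2) - q powr (x / 2)"

text \<open>With \<open>c = - ln q / 2\<close>, the bracket is 2 sinh(c x), and
  \<open>br_mult\<close> is an identity between exponentials.\<close>

lemma qbr_bracket:
  fixes q :: real
  assumes q: "0 < q" "q < 1"
  shows "bracket (qbr q) (1 / (1 - q powr (1/2))^2)"
proof
  define c where "c = - ln q / 2"
  have c: "0 < c" using q by (simp add: c_def)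
  have f: "qbr q = (\<lambda>x. exp (c * x) - exp (- (c * x)))"
    using q by (simp add: fun_eq_iff qbr_def powr_def c_def mult.commute)
  show pos: "0 < qbr q x" if "0 < x" for x
    unfolding f using c that by simp
  show "qbr q x * qbr q y = qbr q z * qbr q (x + y - z) + qbr q (x - z) * qbr q (y - z)" for x y z
  proof -
    have inv: "exp (c * u) * exp (- (c * u)) = 1" for u by (simp flip: exp_add)
    have e: "exp (c * (x + y - z)) = exp (c * x) * exp (c * y) * exp (- (c * z))"
      "exp (- (c * (x + y - z))) = exp (- (c * x)) * exp (- (c * y)) * exp (c * z)"
      "exp (c * (x - z)) = exp (c * x) * exp (- (c * z))" "exp (- (c * (x - z))) = exp (- (c * x)) * exp (c * z)"
      "exp (c * (y - z)) = exp (c * y) * exp (- (c * z))" "exp (- (c * (y - z))) = exp (- (c * y)) * exp (c * z)"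
      by (simp_all add: algebra_simps flip: exp_add)
    show ?thesis unfolding f e using inv[of z] by algebra
  qed
  show "qbr q x * y \<le> qbr q y * x" if xy: "0 < x" "x \<le> y" for x y
  proof -
    \<comment> \<open>A convex function that vanishes at 0 has nondecreasing quotient by
      \<open>x\<close>; this is \<open>br_star\<close>.\<close>
    have "convex_on {0..} (qbr q)"
    proof (rule f''_ge0_imp_convex)
      show "(qbr q has_real_derivative c * exp (c * x) + c * exp (- (c * x))) (at x)" for x
        unfolding f by (auto intro!: derivative_eq_intros)
      show "((\<lambda>x. c * exp (c * x) + c * exp (- (c * x))) has_real_derivative c^2 * qbr q x) (at x)" for x
        unfolding f by (auto intro!: derivative_eq_intros simp: power2_eq_square algebra_simps)
      show "0 \<le> c^2 * qbr q x" if "x \<in> {0..}" for x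
        using c that unfolding f by simp
    qed simp
    then have "qbr q ((1 - x/y) *\<^sub>R 0 + (x/y) *\<^sub>R y) \<le> (1 - x/y) * qbr q 0 + (x/y) * qbr q y"
      using xy by (intro convex_onD) auto
    then show ?thesis using xy by (simp add: f field_simps)
  qed
  show "qbr q (x + y) \<le> 1 / (1 - q powr (1/2))^2 * qbr q x * qbr q y" if xy: "1/2 \<le> x" "1/2 \<le> y" for x y
  proof -
    define d where "d = 1 - q powr (1/2)"
    have d: "0 < d" using q powr01_less_one[of q "1/2"] by (simp add: d_def)
    have de: "d = 1 - exp (- c)" using q by (simp add: d_def c_def powr_def)
    \<comment> \<open>For \<open>u >= 1/2\<close> the decaying exponential is at most
      \<open>exp (- c)\<close> times the growing one. Two such lower bounds, for \<open>x\<close>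
      and \<open>y\<close>, produce the constant 1 / d^2.\<close>
    have b: "d * exp (c * u) \<le> qbr q u" if "1/2 \<le> u" for u
    proof -
      have "- (c * u) \<le> - c + c * u" using c mult_left_mono[of 1 "2*u" c] that by simp
      then have "exp (- (c * u)) \<le> exp (- c) * exp (c * u)" by (simp flip: exp_add)
      then show ?thesis unfolding f de by (simp add: algebra_simps)
    qed
    have "d^2 * qbr q (x + y) \<le> d^2 * exp (c * (x + y))" unfolding f by (intro mult_left_mono) auto
    also have "\<dots> = (d * exp (c * x)) * (d * exp (c * y))"
      by (simp add: power2_eq_square algebra_simps exp_add)
    also have "\<dots> \<le> qbr q x * qbr q y"
      using d xy by (intro mult_mono b less_imp_le[OF pos]) auto
    finally show ?thesis using d by (simp add: d_def[symmetric] field_simps)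
  qed
qed

text \<open>The constant 4 is attained at \<open>x = y = 1/2\<close>.\<close>

interpretation cl: bracket "\<lambda>x. x" 4
proof
  show "x + y \<le> 4 * x * y" if "1/2 \<le> x" "1/2 \<le> y" for x y :: real
  proof -
    have "0 \<le> x * (2 * y - 1) + y * (2 * x - 1)" using that by (intro add_nonneg_nonneg mult_nonneg_nonneg) auto
    then show ?thesis by (simp add: algebra_simps)
  qed
qed (auto simp: algebra_simps)

section \<open>The classical case\<close>

lemma cl_rp: "cl.rp x n = pochhammer x n"
  by (simp add: cl.rp_def pochhammer_prod atLeast0LessThan)

lemma cl_Y_0: "cl.Y 0 = 1 / pi^2"
proof (rule LIMSEQ_unique[OF cl.Y_0_tendsto])
  define W where "W n = (\<Prod>k=1..n. (4 * real k^2) / (4 * real k^2 - 1))" for n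
  have W: "W \<longlonglongrightarrow> pi / 2" unfolding W_def by (rule wallis)
  have Wp: "0 < W n" for n unfolding W_def
  proof (intro prod_pos ballI divide_pos_pos)
    fix k assume "k \<in> {1..n}"
    then have "1 \<le> real k ^ 2" by simp
    then show "0 < 4 * real k^2" "0 < 4 * real k^2 - 1" by linarith+
  qed
  \<comment> \<open>The squared ratio is a partial Wallis product in disguise; its square then
    contributes (2/pi)^2 to the limit.\<close>
  have u: "(cl.rp (1/2) n / cl.rp 1 n)^2 = 1 / (W n * (2 * real n + 1))" for n
  proof (induction n)
    case (Suc n)
    define x where "x = real n"
    have x: "0 \<le> x" by (simp add: x_def)
    have r: "cl.rp (1/2) (Suc n) / cl.rp 1 (Suc n) = cl.rp (1/2) n / cl.rp 1 n * ((2 * x + 1) / 2 / (x + 1))"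
    proof -
      have "1/2 + real n = (2 * x + 1) / 2" "1 + real n = x + 1" by (simp_all add: x_def)
      then show ?thesis by (simp only: cl.rp_Suc times_divide_times_eq)
    qed
    have W: "W (Suc n) = W n * (4 * (x + 1)^2 / ((2 * x + 1) * (2 * x + 3)))"
    proof -
      have "4 * (x + 1)^2 - 1 = (2 * x + 1) * (2 * x + 3)" by (simp add: power2_eq_square algebra_simps)
      moreover have "W (Suc n) = W n * (4 * (x + 1)^2 / (4 * (x + 1)^2 - 1))"
        by (simp add: W_def x_def add.commute)
      ultimately show ?thesis by simp
    qed
    have e: "2 * real (Suc n) + 1 = 2 * x + 3" by (simp add: x_def)
    have nz: "2 * x + 1 \<noteq> 0" "2 * x + 3 \<noteq> 0" "x + 1 \<noteq> 0" "W n \<noteq> 0" using x Wp[of n] by auto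
    show ?case unfolding r W e power_mult_distrib Suc x_def[symmetric] using nz
      by (simp add: power2_eq_square) (simp add: algebra_simps)
  qed (simp add: W_def)
  have "(cl.rp (1/2) n / cl.rp 1 n)^4 * real n * (real n + 1/2) = (real n / (2 * real n + 1)) / (2 * W n^2)" for n
  proof -
    have "(cl.rp (1/2) n / cl.rp 1 n)^4 = ((cl.rp (1/2) n / cl.rp 1 n)^2)^2"
      by (simp only: power_mult[symmetric]) simp
    moreover have "real n + 1/2 = (2 * real n + 1) / 2" by simp
    moreover have "2 * real n + 1 \<noteq> 0" by linarith
    ultimately show ?thesis unfolding u using Wp[of n]
      by (simp only: power_divide) (simp add: power2_eq_square)
  qed
  moreover have "(\<lambda>n. (real n / (2 * real n + 1)) / (2 * W n^2)) \<longlonglongrightarrow> (1/2) / (2 * (pi/2)^2)"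
  proof -
    have "filterlim (\<lambda>n. 2 * real n) at_top sequentially"
      by (rule filterlim_tendsto_pos_mult_at_top[OF tendsto_const _ filterlim_real_sequentially]) simp
    then have "filterlim (\<lambda>n. 1 + 2 * real n) at_top sequentially"
      by (rule filterlim_tendsto_add_at_top[OF tendsto_const])
    then have "(\<lambda>n. (1/2) / (1 + 2 * real n)) \<longlonglongrightarrow> 0"
      by (rule real_tendsto_divide_at_top[OF tendsto_const])
    then have "(\<lambda>n. 1/2 - (1/2) / (1 + 2 * real n)) \<longlonglongrightarrow> 1/2 - 0"
      by (rule tendsto_diff[OF tendsto_const])
    moreover have "1/2 - (1/2) / (1 + 2 * real n) = real n / (2 * real n + 1)" for n
      by (simp add: field_simps)
    ultimately have n: "(\<lambda>n. real n / (2 * real n + 1)) \<longlonglongrightarrow> 1/2" by simp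
    show ?thesis
      by (rule tendsto_divide[OF n tendsto_mult[OF tendsto_const tendsto_power[OF W]]]) simp
  qed
  ultimately show "(\<lambda>n. (cl.rp (1/2) n / cl.rp 1 n)^4 * real n * (real n + 1/2)) \<longlonglongrightarrow> 1 / pi^2"
    by (simp add: power_divide)
qed

theorem classical_sums:
  "(\<lambda>n::nat.
        (pochhammer (1/2 :: real) n ^ 6 * pochhammer (1/2 :: real) (2*n) ^ 3)
        / ((fact (2*n) :: real) ^ 3 * (fact (3*n) :: real) ^ 2)
        * (((1 + 2 * real n) * (1 + 4 * real n) ^ 2 * (3 + 8 * real n)) / (1 + 3 * real n) ^ 2)
        * (1
           + (32 * real n * (1 + 3 * real n) ^ 2 * (1 + 8 * real n))
             / ((1 + 2 * real n) * (1 + 4 * real n) ^ 2 * (3 + 8 * real n))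
           + ((1 + 4 * real n) * (3 + 4 * real n) * (5 + 8 * real n))
             / (16 * (2 + 3 * real n) ^ 2 * (3 + 8 * real n))))
    sums (32 / pi ^ 2)"
proof -
  have "(\<lambda>n. 32 * (cl.D n * cl.tau (real n))) sums (32 * (1 / pi^2))"
    unfolding cl_Y_0[symmetric] by (intro sums_mult cl.D_tau_sums)
  moreover have "32 * (cl.D n * cl.tau (real n)) = 
        (pochhammer (1/2 :: real) n ^ 6 * pochhammer (1/2 :: real) (2*n) ^ 3)
        / ((fact (2*n) :: real) ^ 3 * (fact (3*n) :: real) ^ 2)
        * (((1 + 2 * real n) * (1 + 4 * real n) ^ 2 * (3 + 8 * real n)) / (1 + 3 * real n) ^ 2)
        * (1
           + (32 * real n * (1 + 3 * real n) ^ 2 * (1 + 8 * real n))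
             / ((1 + 2 * real n) * (1 + 4 * real n) ^ 2 * (3 + 8 * real n))
           + ((1 + 4 * real n) * (3 + 4 * real n) * (5 + 8 * real n))
             / (16 * (2 + 3 * real n) ^ 2 * (3 + 8 * real n)))" for n
  proof -
    define x where "x = real n"
    define a b c d e where "a = 1 + 2 * x" and "b = 1 + 4 * x" and "c = 3 + 8 * x"
      and "d = 1 + 3 * x" and "e = 2 + 3 * x"
    have x: "0 \<le> x" by (simp add: x_def)
    have nz: "a \<noteq> 0" "b \<noteq> 0" "c \<noteq> 0" "d \<noteq> 0" "e \<noteq> 0"
      using x by (auto simp: a_def b_def c_def d_def e_def)
    \<comment> \<open>The braces are normalised by the middle term of \<open>tau\<close>, which
      contains five brackets at half-integers; 32 = 2^5 clears their denominators.\<close>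
    have "32 * cl.tau x = a * b^2 * c / d^2 * (1 + 32 * x * d^2 * (1 + 8 * x) / (a * b^2 * c)
       + b * (3 + 4 * x) * (5 + 8 * x) / (16 * e^2 * c))"
    proof -
      have e: "x + 1/2 = a / 2" "2 * x + 1/2 = b / 2" "4 * x + 3/2 = c / 2" "3 * x + 1 = d" "2 * x + 1 = a"
       "3 * x + 2 = e"
        by (auto simp: a_def b_def c_def d_def e_def)
      show ?thesis unfolding cl.tau_def e using nz
        by (simp add: divide_simps) (simp add: eval_nat_numeral algebra_simps)
    qed
    moreover have "cl.D n = (pochhammer (1/2 :: real) n ^ 6 * pochhammer (1/2 :: real) (2*n) ^ 3)
        / ((fact (2*n) :: real) ^ 3 * (fact (3*n) :: real) ^ 2)"
      by (simp add: cl.D_def cl_rp pochhammer_fact)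
    moreover have "32 * (cl.D n * cl.tau x) = cl.D n * (32 * cl.tau x)" by simp
    ultimately show ?thesis unfolding x_def[symmetric] a_def[symmetric] b_def[symmetric] c_def[symmetric]
      d_def[symmetric] e_def[symmetric] by (simp only: mult.assoc)
  qed
  ultimately show ?thesis by simp
qed

section \<open>Finite and infinite q-products\<close>

lemma qpoch_tendsto:
  assumes q: "0 < q" "q < 1"
  shows "qpoch x q \<longlonglongrightarrow> qpoch_inf x q"
  unfolding qpoch_def using q by (intro has_prod_imp_tendsto' qpoch_inf_has_prod) auto

lemma qpoch_Suc: "qpoch x q (Suc n) = qpoch x q n * (1 - q ^ n * x)"
  by (simp add: qpoch_def)

lemma qpoch_Suc': "qpoch x q (Suc n) = (1 - x) * qpoch (q * x) q n"
  unfolding qpoch_def prod.lessThan_Suc_shift by (simp add: mult_ac)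

lemma qpoch_inf_shift:
  assumes q: "0 < q" "q < 1"
  shows "qpoch_inf x q = (1 - x) * qpoch_inf (q * x) q"
proof (rule LIMSEQ_unique)
  show "(\<lambda>n. qpoch x q (Suc n)) \<longlonglongrightarrow> qpoch_inf x q"
    by (rule LIMSEQ_Suc[OF qpoch_tendsto[OF q]])
  show "(\<lambda>n. qpoch x q (Suc n)) \<longlonglongrightarrow> (1 - x) * qpoch_inf (q * x) q"
    unfolding qpoch_Suc' by (intro tendsto_intros qpoch_tendsto q)
qed

lemma qpoch_pos:
  assumes q: "0 < q" "q < 1" and x: "x < 1"
  shows "0 < qpoch x q n"
  unfolding qpoch_def
proof (intro prod_pos ballI)
  fix j
  have "q ^ j * x < 1"
  proof (cases "0 \<le> x")
    case True
    have "q ^ j * x \<le> 1 * x" using q True by (intro mult_right_mono power_le_one) auto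
    then show ?thesis using x by simp
  next
    case False
    then show ?thesis using q by (smt (verit) mult_pos_neg zero_less_power)
  qed
  then show "0 < 1 - q ^ j * x" by simp
qed

text \<open>A product that converges in the sense of \<open>has_prod\<close> has value 0 only if
  some factor is 0, and for \<open>x < 1\<close> all factors are positive.\<close>

lemma qpoch_inf_nonzero:
  assumes q: "0 < q" "q < 1" and x: "x < 1"
  shows "qpoch_inf x q \<noteq> 0"
proof
  assume "qpoch_inf x q = 0"
  then have "(\<lambda>j. 1 - q ^ j * x) has_prod 0"
    using qpoch_inf_has_prod[of q x] q by simp
  then have "0 \<in> range (\<lambda>j. 1 - q ^ j * x)" by (rule has_prod_0D)
  then obtain j where "1 - q ^ j * x = 0" by auto
  then have "qpoch x q (Suc j) = 0" by (simp add: qpoch_Suc)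
  then show False using qpoch_pos[OF assms, of "Suc j"] by simp
qed

section \<open>The q-case\<close>

context
  fixes q :: real
  assumes q: "0 < q" "q < 1"
begin

interpretation qb: bracket "qbr q" "1 / (1 - q powr (1/2))^2"
  by (rule qbr_bracket[OF q])

definition qnum :: "real \<Rightarrow> real" where "qnum x = 1 - q powr x"

lemma qnum_pos: "0 < x \<Longrightarrow> 0 < qnum x"
  using q powr01_less_one[of q x] by (simp add: qnum_def)

lemma qbr_g: "qbr q x = qnum x * q powr (- x / 2)"
  using q by (simp add: qbr_def qnum_def left_diff_distrib flip: powr_add)

lemma one_minus_power_mult_powr: "1 - q ^ n * q powr x = qnum (x + real n)"
  using q by (simp add: qnum_def powr_add powr_realpow mult.commute)

text \<open>The exponent is minus the sum of \<open>(1/2 + j) / 2\<close> over \<open>j < n\<close>,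
  collected from the symmetric normalisation of \<open>qbr\<close>.\<close>

lemma rp_half: "qb.rp (1/2) n = qpoch (q powr (1/2)) q n * q powr (- (real n ^ 2 / 4))"
proof (induction n)
  case (Suc n)
  have e: "- (real (Suc n) ^ 2 / 4) = - (real n ^ 2 / 4) + (- (1/2 + real n) / 2)"
    by (simp add: power2_eq_square field_simps)
  show ?case unfolding qb.rp_Suc qpoch_Suc Suc one_minus_power_mult_powr qbr_g[of "1/2 + real n"] e powr_add by simp
qed (use q in \<open>simp add: qpoch_def\<close>)

lemma rp_one: "qb.rp 1 n = qpoch q q n * q powr (- ((real n ^ 2 + real n) / 4))"
proof (induction n)
  case (Suc n)
  have e: "- ((real (Suc n) ^ 2 + real (Suc n)) / 4) = - ((real n ^ 2 + real n) / 4) + (- (1 + real n) / 2)"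
    by (simp add: power2_eq_square field_simps)
  have qnum: "1 - q ^ n * q = qnum (1 + real n)" using one_minus_power_mult_powr[of n 1] q by simp
  show ?case unfolding qb.rp_Suc qpoch_Suc Suc qnum qbr_g[of "1 + real n"] e powr_add by simp
qed (use q in \<open>simp add: qpoch_def\<close>)

text \<open>The ratio of shifted factorials carries q^(n/4). Its fourth power q^n cancels the powers
  of the two brackets up to the constant q^(-1/4).\<close>

lemma q_Y_0:
  "qb.Y 0 = qpoch_inf (q powr (1/2)) q ^ 4 / qpoch_inf q q ^ 4 * q powr (- (1/4))"
proof (rule LIMSEQ_unique[OF qb.Y_0_tendsto])
  let ?P = "\<lambda>n. qpoch (q powr (1/2)) q n" and ?Q = "\<lambda>n. qpoch q q n"
  have "(qb.rp (1/2) n / qb.rp 1 n)^4 * qbr q (real n) * qbr q (real n + 1/2)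
     = (?P n / ?Q n)^4 * qnum (real n) * qnum (real n + 1/2) * q powr (- (1/4))" for n
  proof -
    have 1: "(qb.rp (1/2) n / qb.rp 1 n) = ?P n / ?Q n * q powr (real n / 4)"
    proof -
      have "q powr (- (real n ^ 2 / 4)) = q powr (- ((real n ^ 2 + real n) / 4)) * q powr (real n / 4)"
        by (simp add: add_divide_distrib flip: powr_add)
      then show ?thesis using q by (simp add: rp_half rp_one)
    qed
    have 2: "(q powr (real n / 4))^4 * q powr (- real n / 2) * q powr (- (real n + 1/2) / 2) = q powr (- (1/4))"
      using q by (simp add: powr_power flip: powr_add) (simp add: field_simps)
    show ?thesis unfolding 1 qbr_g power_mult_distrib 2[symmetric] by (simp only: mult_ac)
  qed
  moreover have "(\<lambda>n. (?P n / ?Q n)^4 * qnum (real n) * qnum (real n + 1/2) * q powr (- (1/4)))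
    \<longlonglongrightarrow> (qpoch_inf (q powr (1/2)) q / qpoch_inf q q)^4 * (1 - 0) * (1 - 0 * q powr (1/2)) * q powr (- (1/4))"
  proof (intro tendsto_mult tendsto_power tendsto_divide tendsto_const qpoch_tendsto q qpoch_inf_nonzero)
    have p: "(\<lambda>n. q ^ n) \<longlonglongrightarrow> 0" using q by (intro LIMSEQ_realpow_zero) auto
    have "(\<lambda>n. 1 - q ^ n) \<longlonglongrightarrow> 1 - 0" by (intro tendsto_intros p)
    then show "(\<lambda>n. qnum (real n)) \<longlonglongrightarrow> 1 - 0" using q by (simp add: qnum_def powr_realpow)
    have "(\<lambda>n. 1 - q ^ n * q powr (1/2)) \<longlonglongrightarrow> 1 - 0 * q powr (1/2)" by (intro tendsto_intros p)
    then show "(\<lambda>n. qnum (real n + 1/2)) \<longlonglongrightarrow> 1 - 0 * q powr (1/2)" using one_minus_power_mult_powr[of _ "1/2"] by (simp add: add.commute)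
  qed
  ultimately show "(\<lambda>n. (qb.rp (1/2) n / qb.rp 1 n)^4 * qbr q (real n) * qbr q (real n + 1/2))
     \<longlonglongrightarrow> qpoch_inf (q powr (1/2)) q ^ 4 / qpoch_inf q q ^ 4 * q powr (- (1/4))"
    by (simp add: power_divide)
qed

definition qcoef :: "nat \<Rightarrow> real" where
  "qcoef n = qpoch (q powr (1/2)) q n ^ 6 * qpoch (q powr (1/2)) q (2*n) ^ 3 / (qpoch q q (2*n) ^ 3 * qpoch q q (3*n) ^ 2)"

lemma q_D: "qb.D n = q powr (3 * real n) * q ^ (3 * n^2) * qcoef n"
proof -
  have e1: "q ^ (3 * n^2) = q powr (3 * real n ^ 2)"
    using q powr_realpow[of q "3 * n^2"] by simp
  have "(q powr (- (real n ^ 2 / 4)))^6 * (q powr (- (real (2*n) ^ 2 / 4)))^3 =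
     q powr (3 * real n) * q powr (3 * real n ^ 2) *
     ((q powr (- ((real (2*n) ^ 2 + real (2*n)) / 4)))^3 * (q powr (- ((real (3*n) ^ 2 + real (3*n)) / 4)))^2)"
    using q by (simp add: powr_power power_mult_distrib flip: powr_add) (simp add: field_simps)
  then have "(q powr (- (real n ^ 2 / 4)))^6 * (q powr (- (real (2*n) ^ 2 / 4)))^3 /
      ((q powr (- ((real (2*n) ^ 2 + real (2*n)) / 4)))^3 * (q powr (- ((real (3*n) ^ 2 + real (3*n)) / 4)))^2)
      = q powr (3 * real n) * q ^ (3 * n^2)"
    using q by (simp only: e1) simp
  moreover have "a * a' * (b * b') / (c * c' * (d * d')) = a' * b' / (c' * d') * (a * b / (c * d))"
    for a b c d a' b' c' d' :: real
    by (simp add: mult_ac)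
  ultimately show ?thesis
    unfolding qb.D_def rp_half rp_one qcoef_def power_mult_distrib by (simp only:)
qed

text \<open>The factor q^(3n) is the part of the power in \<open>q_D\<close> beyond q^(3n^2).
  Multiplying \<open>tau\<close> by it leaves the powers 1, q^(2n) and q^(4n+1) on the three
  terms.\<close>

lemma q_tau:
  "qb.tau (real n) * q powr (3 * real n) = q powr (- (1/4)) * 
    (qnum (2 * real n) * qnum (4 * real n + 1/2)
     + q ^ (2*n) * (qnum (real n + 1/2)^2 * qnum (2 * real n + 1/2)^2 * qnum (4 * real n + 3/2)
        / (qnum (3 * real n + 1)^2 * qnum (2 * real n + 1)))
     + q ^ (4*n + 1) * (qnum (real n + 1/2)^4 * qnum (2 * real n + 1/2)^3 * qnum (2 * real n + 3/2) * qnum (4 * real n + 5/2)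
        / (qnum (3 * real n + 1)^2 * qnum (3 * real n + 2)^2 * qnum (2 * real n + 1)^3)))"
proof -
  \<comment> \<open>Every power that occurs is a monomial in \<open>s\<close> and \<open>t\<close>,
    up to inversion, so exponents linear in \<open>n\<close> become natural-number
    exponents.\<close>
  define s where "s = q powr (real n / 2)"
  define t where "t = q powr (1/4)"
  have st: "0 < s" "0 < t" using q by (auto simp: s_def t_def)
  have pw: "q powr (- x / 2) = 1 / (s ^ i * t ^ j)" if "x = real i * real n + real j / 2" for x i j
  proof -
    have "s ^ i * t ^ j = q powr (real i * (real n / 2)) * q powr (real j * (1/4))"
      using q by (simp add: s_def t_def powr_power)
    also have "\<dots> = q powr (x / 2)"
      unfolding that powr_add[symmetric] by (simp add: add_divide_distrib)
    finally show ?thesis by (simp add: powr_minus_divide)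
  qed
  have p: "q powr (- (2 * real n) / 2) = 1 / (s^2 * t^0)"
    "q powr (- (4 * real n + 1/2) / 2) = 1 / (s^4 * t^1)"
    "q powr (- (real n + 1/2) / 2) = 1 / (s^1 * t^1)"
    "q powr (- (2 * real n + 1/2) / 2) = 1 / (s^2 * t^1)"
    "q powr (- (4 * real n + 3/2) / 2) = 1 / (s^4 * t^3)"
    "q powr (- (3 * real n + 1) / 2) = 1 / (s^3 * t^2)"
    "q powr (- (2 * real n + 1) / 2) = 1 / (s^2 * t^2)"
    "q powr (- (2 * real n + 3/2) / 2) = 1 / (s^2 * t^3)"
    "q powr (- (4 * real n + 5/2) / 2) = 1 / (s^4 * t^5)"
    "q powr (- (3 * real n + 2) / 2) = 1 / (s^3 * t^4)"
    by (rule pw; simp)+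
  have p2: "q powr (3 * real n) = s^6" "q powr (- (1/4)) = 1 / t" "q ^ (2*n) = s^4" "q ^ (4*n + 1) = s^8 * t^4"
  proof -
    show "q powr (3 * real n) = s^6" using q by (simp add: s_def powr_power)
    show "q powr (- (1/4)) = 1 / t" using q by (simp add: t_def powr_minus field_simps)
    have "s^4 = q powr (real (2*n))" using q by (simp add: s_def powr_power)
    then show "q ^ (2*n) = s^4" using q powr_realpow[of q "2*n"] by simp
    have "s^8 * t^4 = q powr (real (4*n+1))" using q by (simp add: s_def t_def powr_power powr_add)
    then show "q ^ (4*n+1) = s^8 * t^4" using q powr_realpow[of q "4*n+1"] by simp
  qed
  have nz: "qnum (3 * real n + 1) \<noteq> 0" "qnum (3 * real n + 2) \<noteq> 0" "qnum (2 * real n + 1) \<noteq> 0"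
    by (auto intro!: qnum_pos less_imp_neq[symmetric])
  have 1: "x * (1 / (s^2 * t^0)) * (d * (1 / (s^4 * t^1))) * s^6 = 1 / t * (x * d)" for x d
    using st by (simp add: field_simps flip: power_add)
  have 2: "(a * (1 / (s^1 * t^1)))^2 * (b * (1 / (s^2 * t^1)))^2 * (d * (1 / (s^4 * t^3))) /
      ((y * (1 / (s^3 * t^2)))^2 * (z * (1 / (s^2 * t^2)))) * s^6
     = 1 / t * (s^4 * (a^2 * b^2 * d / (y^2 * z)))" if "y \<noteq> 0" "z \<noteq> 0" for a b d y z
    using st that by (simp add: field_simps power_mult_distrib) (simp add: eval_nat_numeral)
  have 3: "(a * (1 / (s^1 * t^1)))^4 * (b * (1 / (s^2 * t^1)))^3 * (c * (1 / (s^2 * t^3))) * (d * (1 / (s^4 * t^5))) /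
      ((y * (1 / (s^3 * t^2)))^2 * (w * (1 / (s^3 * t^4)))^2 * (z * (1 / (s^2 * t^2)))^3) * s^6
     = 1 / t * (s^8 * t^4 * (a^4 * b^3 * c * d / (y^2 * w^2 * z^3)))"
      if "y \<noteq> 0" "z \<noteq> 0" "w \<noteq> 0" for a b c d w y z
    using st that by (simp add: field_simps power_mult_distrib) (simp add: eval_nat_numeral)
  show ?thesis unfolding qb.tau_def qbr_g p p2 distrib_left distrib_right
    by (simp only: 1 2[OF nz(1,3)] 3[OF nz(1,3,2)])
qed

theorem q_sums:
  "(\<lambda>n::nat.
        q ^ (3 * n\<^sup>2)
        * (qpoch (q powr (1/2)) q n ^ 6 * qpoch (q powr (3/2)) q (2*n) ^ 3
            * (1 - q powr (real n + 1/2)) ^ 2 * (1 - q powr (4 * real n + 3/2)))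
        / (qpoch q q (2*n) ^ 3 * qpoch (q ^ 2) q (3*n) ^ 2
            * (1 - q ^ (2*n + 1)) * (1 - q powr (2 * real n + 1/2)))
        * (q ^ (2*n)
           + ((1 + q powr (real n + 1/2)) * (1 - q ^ (2*n)) * (1 - q ^ (3*n + 1)) ^ 2
                * (1 - q powr (4 * real n + 1/2)))
             / ((1 - q powr (real n + 1/2)) * (1 - q powr (2 * real n + 1/2)) ^ 2
                * (1 - q powr (4 * real n + 3/2)))
           + (q ^ (4*n + 1) * (1 - q powr (2 * real n + 1/2)) * (1 - q powr (2 * real n + 3/2))
                * (1 - q powr (4 * real n + 5/2)))
             / ((1 + q powr (real n + 1/2)) ^ 2 * (1 - q ^ (3*n + 2)) ^ 2
                * (1 - q powr (4 * real n + 3/2)))))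
    sums
      ((qpoch_inf (q powr (1/2)) q * qpoch_inf (q powr (3/2)) q ^ 3)
        / (qpoch_inf q q ^ 2 * qpoch_inf (q ^ 2) q ^ 2))" (is "?f sums ?s")
proof -
  \<comment> \<open>The theorem has bases q^(3/2) and q^2 where \<open>qcoef\<close> has q^(1/2) and
    q. Each change of base releases an initial factor, \<open>qnum (1/2)\<close> three times and
    \<open>qnum 1\<close> twice; q^(1/4) cancels the constant from \<open>q_tau\<close> and
    \<open>q_Y_0\<close>.\<close>
  define c where "c = q powr (1/4) * qnum 1 ^ 2 / qnum (1/2) ^ 3"
  have q32: "q powr (3/2) = q * q powr (1/2)"
    using q powr_add[of q 1 "1/2"] by simp
  have c: "qnum 1 \<noteq> 0" "qnum (1/2) \<noteq> 0" by (auto intro!: qnum_pos less_imp_neq[symmetric])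
  have n1: "1 - q = qnum 1" "1 - q powr (1/2) = qnum (1/2)" using q by (simp_all add: qnum_def)
  have q4: "q powr (1/4) * q powr (- (1/4)) = 1" using q by (simp flip: powr_add)
  have summand: "?f n = c * (qb.D n * qb.tau (real n))" for n
  proof -
    define h where "h = q powr (real n + 1/2)"
    define a where "a = qnum (real n + 1/2)"
    define b where "b = qnum (2 * real n + 1/2)"
    define b' where "b' = qnum (2 * real n + 3/2)"
    define d where "d = qnum (4 * real n + 1/2)"
    define d' where "d' = qnum (4 * real n + 3/2)"
    define d'' where "d'' = qnum (4 * real n + 5/2)"
    define x where "x = qnum (2 * real n)"
    define y where "y = qnum (3 * real n + 1)"
    define y' where "y' = qnum (3 * real n + 2)"
    define u where "u = q ^ (2*n)"
    define v where "v = q ^ (4*n + 1)"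
    define A where "A = qpoch (q powr (1/2)) q n"
    define B where "B = qpoch (q powr (1/2)) q (2*n)"
    define C where "C = qpoch q q (2*n)"
    define E where "E = qpoch q q (3*n)"
    define w where "w = q ^ (3 * n^2)"
    have hp: "1 + h \<noteq> 0" using q by (simp add: h_def add_pos_pos less_imp_neq[symmetric])
    have nz: "a \<noteq> 0" "b \<noteq> 0" "d' \<noteq> 0" "y \<noteq> 0" "y' \<noteq> 0"
      unfolding a_def b_def d'_def y_def y'_def by (auto intro!: qnum_pos less_imp_neq[symmetric])
    have q1: "q < 1" "q powr (1/2) < 1" using q powr01_less_one[of q "1/2"] by auto
    have nzP: "C \<noteq> 0" "E \<noteq> 0"
      unfolding C_def E_def using qpoch_pos[OF q q1(1)] by (auto simp: less_imp_neq[symmetric])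
    have pw: "1 - q ^ (2*n) = x" "1 - q ^ (3*n + 1) = y" "1 - q ^ (3*n + 2) = y'"
      using q powr_realpow[of q "2*n"] powr_realpow[of q "3*n+1"] powr_realpow[of q "3*n+2"]
      by (simp_all add: x_def y_def y'_def qnum_def add.commute)
    \<comment> \<open>Difference of squares: 1 - h^2 = (1 - h)(1 + h) with h = q^(n+1/2). This is
      the source of the factors \<open>1 + h\<close> in the braces.\<close>
    have z: "1 - q ^ (2*n + 1) = a * (1 + h)" "qnum (2 * real n + 1) = a * (1 + h)"
    proof -
      have "h * h = q powr (real (2*n+1))" using q by (simp add: h_def add.commute flip: powr_add)
      then show "1 - q ^ (2*n + 1) = a * (1 + h)"
        using q powr_realpow[of q "2*n+1"] by (simp add: a_def qnum_def h_def[symmetric] algebra_simps)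
      then show "qnum (2 * real n + 1) = a * (1 + h)"
        using q powr_realpow[of q "2*n+1"] by (simp add: qnum_def add.commute)
    qed
    have P3: "qpoch (q powr (3/2)) q (2*n) = B * b / qnum (1/2)"
    proof -
      have "qnum (1/2) * qpoch (q powr (3/2)) q (2*n) = B * b"
        using qpoch_Suc'[of "q powr (1/2)" q "2*n"] qpoch_Suc[of "q powr (1/2)" q "2*n"] one_minus_power_mult_powr[of "2*n" "1/2"]
        by (simp add: B_def b_def n1 q32 add.commute)
      then show ?thesis using c by (simp add: field_simps)
    qed
    have P2: "qpoch (q ^ 2) q (3*n) = E * y / qnum 1"
    proof -
      have "qnum 1 * qpoch (q ^ 2) q (3*n) = E * y"
        using qpoch_Suc'[of q q "3*n"] qpoch_Suc[of q q "3*n"] pw(2) n1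
        by (simp add: E_def power2_eq_square mult.commute)
      then show ?thesis using c by (simp add: field_simps)
    qed
    have "?f n = w * (A^6 * (B * b / qnum (1/2))^3 * a^2 * d') / (C^3 * (E * y / qnum 1)^2 * (a * (1 + h)) * b) *
       (u + ((1 + h) * x * y^2 * d) / (a * b^2 * d') + (v * b * b' * d'') / ((1 + h)^2 * y'^2 * d'))"
      unfolding pw z P3 P2 A_def C_def u_def v_def w_def h_def
      unfolding a_def b_def b'_def d_def d'_def d''_def qnum_def ..
    also have "w * (A^6 * (B * b / qnum (1/2))^3 * a^2 * d') / (C^3 * (E * y / qnum 1)^2 * (a * (1 + h)) * b)
      = (qnum 1 ^ 2 / qnum (1/2) ^ 3) * (w * (A^6 * B^3 / (C^3 * E^2))) * (a * b^2 * d' / (y^2 * (1 + h)))"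
      using nz(1,2) by (simp add: power_divide power_mult_distrib power2_eq_square power3_eq_cube mult_ac)
    also have "(qnum 1 ^ 2 / qnum (1/2) ^ 3) * (w * (A^6 * B^3 / (C^3 * E^2))) * (a * b^2 * d' / (y^2 * (1 + h))) *
        (u + ((1 + h) * x * y^2 * d) / (a * b^2 * d') + (v * b * b' * d'') / ((1 + h)^2 * y'^2 * d'))
      = (qnum 1 ^ 2 / qnum (1/2) ^ 3) * (w * (A^6 * B^3 / (C^3 * E^2))) *
       (x * d + u * (a^2 * b^2 * d' / (y^2 * (a * (1 + h)))) + v * (a^4 * b^3 * b' * d'' / (y^2 * y'^2 * (a * (1 + h))^3)))"
    proof -
      have 1: "a * b^2 * d' / (y^2 * (1 + h)) * u = u * (a^2 * b^2 * d' / (y^2 * (a * (1 + h))))"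
        using nz by (simp add: power2_eq_square mult_ac)
      have 2: "a * b^2 * d' / (y^2 * (1 + h)) * (((1 + h) * x * y^2 * d) / (a * b^2 * d')) = x * d"
        using nz hp by simp
      have 3: "a * b^2 * d' / (y^2 * (1 + h)) * ((v * b * b' * d'') / ((1 + h)^2 * y'^2 * d'))
        = v * (a^4 * b^3 * b' * d'' / (y^2 * y'^2 * (a * (1 + h))^3))"
      proof -
        \<comment> \<open>Generalising \<open>1 + h\<close> to a variable \<open>H\<close> keeps
          that sum an atom during simplification.\<close>
        have "a * b^2 * d' / (y^2 * H) * ((v * b * b' * d'') / (H^2 * y'^2 * d'))
          = v * (a^4 * b^3 * b' * d'' / (y^2 * y'^2 * (a * H)^3))" for H
          using nz by (simp add: power_mult_distrib power2_eq_square power3_eq_cube power4_eq_xxxx mult_ac)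
        then show ?thesis .
      qed
      show ?thesis by (simp only: mult.assoc[of "(qnum 1 ^ 2 / qnum (1/2) ^ 3) * (w * (A^6 * B^3 / (C^3 * E^2)))"]
        distrib_left[of "a * b^2 * d' / (y^2 * (1 + h))"] 1 2 3 add.commute[of "u * (a^2 * b^2 * d' / (y^2 * (a * (1 + h))))" "x * d"])
    qed
    also have "\<dots> = (qnum 1 ^ 2 / qnum (1/2) ^ 3) * (w * qcoef n) * (q powr (1/4) * (qb.tau (real n) * q powr (3 * real n)))"
      unfolding q_tau mult.assoc[symmetric] q4
      by (simp add: qcoef_def A_def B_def C_def E_def z a_def b_def b'_def d_def d'_def d''_def x_def y_def y'_def u_def v_def)
    also have "\<dots> = c * (qb.D n * qb.tau (real n))"
      by (simp add: c_def q_D w_def)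
    finally show ?thesis .
  qed
  have s: "?s = c * qb.Y 0"
  proof -
    define X where "X = qpoch_inf (q powr (3/2)) q"
    define W where "W = qpoch_inf (q ^ 2) q"
    have "q ^ 2 < 1" using q by (simp add: power_less_one_iff)
    then have W: "W \<noteq> 0" unfolding W_def by (rule qpoch_inf_nonzero[OF q])
    have 1: "qpoch_inf (q powr (1/2)) q = qnum (1/2) * X"
      using qpoch_inf_shift[OF q, of "q powr (1/2)"] by (simp add: X_def n1 q32)
    have 2: "qpoch_inf q q = qnum 1 * W"
      using qpoch_inf_shift[OF q, of q] by (simp add: W_def n1 power2_eq_square)
    have "c * qb.Y 0 = (qnum 1 ^ 2 / qnum (1/2) ^ 3) * ((qnum (1/2) * X)^4 / (qnum 1 * W)^4) * (q powr (1/4) * q powr (- (1/4)))"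
      by (simp add: c_def q_Y_0 1 2)
    also have "\<dots> = (qnum (1/2) * X) * X^3 / ((qnum 1 * W)^2 * W^2)"
      unfolding q4 using c W
      by (simp add: power_mult_distrib power2_eq_square power3_eq_cube power4_eq_xxxx mult_ac)
    finally show ?thesis by (simp add: 1 2 X_def W_def)
  qed
  show ?thesis unfolding summand s by (intro sums_mult qb.D_tau_sums)
qed

end

theorem mainTheorem13:
  shows "(\<forall>q::real. 0 < q \<and> q < 1 \<longrightarrow>
    (\<lambda>n::nat.
        q ^ (3 * n\<^sup>2)
        * (qpoch (q powr (1/2)) q n ^ 6 * qpoch (q powr (3/2)) q (2*n) ^ 3
            * (1 - q powr (real n + 1/2)) ^ 2 * (1 - q powr (4 * real n + 3/2)))
        / (qpoch q q (2*n) ^ 3 * qpoch (q ^ 2) q (3*n) ^ 2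
            * (1 - q ^ (2*n + 1)) * (1 - q powr (2 * real n + 1/2)))
        * (q ^ (2*n)
           + ((1 + q powr (real n + 1/2)) * (1 - q ^ (2*n)) * (1 - q ^ (3*n + 1)) ^ 2
                * (1 - q powr (4 * real n + 1/2)))
             / ((1 - q powr (real n + 1/2)) * (1 - q powr (2 * real n + 1/2)) ^ 2
                * (1 - q powr (4 * real n + 3/2)))
           + (q ^ (4*n + 1) * (1 - q powr (2 * real n + 1/2)) * (1 - q powr (2 * real n + 3/2))
                * (1 - q powr (4 * real n + 5/2)))
             / ((1 + q powr (real n + 1/2)) ^ 2 * (1 - q ^ (3*n + 2)) ^ 2
                * (1 - q powr (4 * real n + 3/2)))))
    sums
      ((qpoch_inf (q powr (1/2)) q * qpoch_inf (q powr (3/2)) q ^ 3)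
        / (qpoch_inf q q ^ 2 * qpoch_inf (q ^ 2) q ^ 2)))
  \<and>
    (\<lambda>n::nat.
        (pochhammer (1/2 :: real) n ^ 6 * pochhammer (1/2 :: real) (2*n) ^ 3)
        / ((fact (2*n) :: real) ^ 3 * (fact (3*n) :: real) ^ 2)
        * (((1 + 2 * real n) * (1 + 4 * real n) ^ 2 * (3 + 8 * real n)) / (1 + 3 * real n) ^ 2)
        * (1
           + (32 * real n * (1 + 3 * real n) ^ 2 * (1 + 8 * real n))
             / ((1 + 2 * real n) * (1 + 4 * real n) ^ 2 * (3 + 8 * real n))
           + ((1 + 4 * real n) * (3 + 4 * real n) * (5 + 8 * real n))
             / (16 * (2 + 3 * real n) ^ 2 * (3 + 8 * real n))))
    sums (32 / pi ^ 2)"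
  by (intro conjI allI impI q_sums classical_sums) auto

end
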